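(* Let $n\geq 2$. (i) If $n$ is even then $T_L$ is Poisson simple. (ii) If $n$ is odd then $T_L=U[z_n^{\pm1}]$, $U$ is a Poisson simple subalgebra of $T_L$ and $z_n$ is Poisson central. (iii) The non-zero proper Poisson prime ideals of $F_n^L$ are the ideals $(z_n-\lambda)F_n$, $\lambda\in\mathbb{K}$, if $n$ is odd, and $z_nF_n$ and the ideals $z_nF_n+(z_{n-1}-\lambda)F_n$, $\lambda\in\mathbb{K}^*$, if $n$ is even.
   Context: $\mathbb{K}$ is an algebraically closed field of characteristic $0$, $\mathbb{K}^*=\mathbb{K}\setminus\{0\}$. $F_n=\mathbb{K}[x_1,\dots,x_n]$ is the polynomial algebra. $F_n^L$ is $F_n$ with the Poisson bracket given by: $\{x_i,x_{i+1}\}=x_ix_{i+1}-1$ for $1\leq i\leq n-1$; $\{x_i,x_j\}=x_ix_j$ for $i\geq1$, $i+1<j\leq n$, $j-i$ odd; $\{x_i,x_j\}=-x_ix_j$ for $i\geq1$, $i+1<j\leq n$, $j-i$ even. In $F_n$ define $z_{-1}=0$, $z_0=1$, $z_{i+1}=z_ix_{i+1}-z_{i-1}$ for $0\leq i\leq n-1$. $T_L$ is the localization of $F_n$ at the multiplicatively closed set generated by $z_1,\dots,z_n$, with the extended Poisson bracket; the $z_i$ are algebraically independent and $T_L=\mathbb{K}[z_1^{\pm1},\dots,z_n^{\pm1}]$. $U=\mathbb{K}[z_1^{\pm1},\dots,z_{n-1}^{\pm1}]$. A Poisson ideal of a Poisson algebra $A$ is an ideal $I$ with $\{I,A\}\subseteq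 I$; a Poisson prime ideal is a Poisson ideal that is prime; $A$ is Poisson simple if its only Poisson ideals are $0$ and $A\neq 0$; an element $a$ is Poisson central if $\{a,A\}=0$. *)

theory Defs
  imports
    "HOL-Library.Poly_Mapping"
    "HOL-Computational_Algebra.Computational_Algebra"
    "HOL-Algebra.Algebraic_Closure_Type"
    "HOL-Algebra.Generated_Rings"
begin

section \<open>Poisson ideals and Poisson simplicity\<close>

text \<open>All algebras are subrings of an ambient commutative ring given by a type; \<open>ring_on A\<close> is the
  \<^theory>\<open>HOL-Algebra.Ring\<close> structure induced on the subset \<open>A\<close>. A bracket is a binary operation on
  the ambient ring.\<close>

definition ring_on :: "'r::comm_ring_1 set \<Rightarrow> 'r ring" where
  "ring_on A = ring_of_type_algebra\<lparr>carrier := A\<rparr>"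

definition poisson_ideal :: "('r \<Rightarrow> 'r \<Rightarrow> 'r) \<Rightarrow> 'r::comm_ring_1 set \<Rightarrow> 'r set \<Rightarrow> bool" where
  "poisson_ideal br A I \<longleftrightarrow> ideal I (ring_on A) \<and> (\<forall>a\<in>I. \<forall>b\<in>A. br a b \<in> I)"

text \<open>\<^const>\<open>primeideal\<close> includes properness.\<close>

definition poisson_prime_ideal :: "('r \<Rightarrow> 'r \<Rightarrow> 'r) \<Rightarrow> 'r::comm_ring_1 set \<Rightarrow> 'r set \<Rightarrow> bool" where
  "poisson_prime_ideal br A P \<longleftrightarrow> poisson_ideal br A P \<and> primeideal P (ring_on A)"

definition poisson_simple :: "('r \<Rightarrow> 'r \<Rightarrow> 'r) \<Rightarrow> 'r::comm_ring_1 set \<Rightarrow> bool" where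
  "poisson_simple br A \<longleftrightarrow> A \<noteq> {0} \<and> {I. poisson_ideal br A I} = {{0}, A}"

definition poisson_central :: "('r \<Rightarrow> 'r \<Rightarrow> 'r) \<Rightarrow> 'r::comm_ring_1 set \<Rightarrow> 'r \<Rightarrow> bool" where
  "poisson_central br A a \<longleftrightarrow> a \<in> A \<and> (\<forall>b\<in>A. br a b = 0)"

text \<open>\<open>k\<close> is the image of the base field.\<close>

definition poisson_subalgebra ::
    "'r set \<Rightarrow> ('r \<Rightarrow> 'r \<Rightarrow> 'r) \<Rightarrow> 'r::comm_ring_1 set \<Rightarrow> 'r set \<Rightarrow> bool" where
  "poisson_subalgebra k br A B \<longleftrightarrow>
     subring B (ring_on A) \<and> k \<subseteq> B \<and> (\<forall>a\<in>B. \<forall>b\<in>B. br a b \<in> B)"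


section \<open>Polynomials and their field of fractions\<close>

text \<open>Polynomials in the variables \<open>x\<^sub>i\<close>, \<open>i :: nat\<close>: a monomial is its exponent function.\<close>

type_synonym 'k mpol = "(nat \<Rightarrow>\<^sub>0 nat) \<Rightarrow>\<^sub>0 'k"

definition Const :: "'k \<Rightarrow> 'k::field mpol" where
  "Const c = Poly_Mapping.single 0 c"

definition xvar :: "nat \<Rightarrow> 'k::field mpol" where
  "xvar i = Poly_Mapping.single (Poly_Mapping.single i 1) 1"

definition Fpoly :: "nat \<Rightarrow> 'k::field mpol set" where
  "Fpoly n = {p. \<forall>m \<in> Poly_Mapping.keys p. Poly_Mapping.keys m \<subseteq> {1..n}}"

text \<open>Formal partial derivative with respect to \<open>x\<^sub>i\<close>. The truncated subtraction of exponents is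
  harmless, since the coefficient vanishes when \<open>x\<^sub>i\<close> does not occur.\<close>

definition pd :: "nat \<Rightarrow> 'k::field mpol \<Rightarrow> 'k mpol" where
  "pd i p = (\<Sum>m\<in>Poly_Mapping.keys p. Poly_Mapping.single (m - Poly_Mapping.single i 1)
               (of_nat (Poly_Mapping.lookup m i) * Poly_Mapping.lookup p m))"

abbreviation of_pol :: "'k::field mpol \<Rightarrow> 'k mpol fract" where
  "of_pol p \<equiv> Fract p 1"

lemma pd_superset:
  assumes "finite S" "Poly_Mapping.keys p \<subseteq> S"
  shows "pd i p = (\<Sum>m\<in>S. Poly_Mapping.single (m - Poly_Mapping.single i 1)
               (of_nat (Poly_Mapping.lookup m i) * Poly_Mapping.lookup p m))"
  unfolding pd_def
  by (rule sum.mono_neutral_left) (use assms in \<open>auto simp: in_keys_iff\<close>)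

lemma pd_add: "pd i (p + q) = pd i p + pd i q"
proof -
  let ?S = "Poly_Mapping.keys p \<union> Poly_Mapping.keys q"
  have S: "finite ?S" "Poly_Mapping.keys (p + q) \<subseteq> ?S"
    using Poly_Mapping.keys_add[of p q] by auto
  show ?thesis
    unfolding pd_superset[OF S] pd_superset[OF S(1) Un_upper1] pd_superset[OF S(1) Un_upper2]
    by (simp add: lookup_add algebra_simps single_add sum.distrib)
qed

lemma pd_0: "pd i 0 = 0"
  by (simp add: pd_def)

lemma pd_sum: "pd i (sum f A) = (\<Sum>a\<in>A. pd i (f a))"
  by (induction A rule: infinite_finite_induct) (auto simp: pd_add pd_0)

lemma pd_single:
  "pd i (Poly_Mapping.single m c) =
     Poly_Mapping.single (m - Poly_Mapping.single i 1) (of_nat (Poly_Mapping.lookup m i) * c)"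
  by (subst pd_superset[where S = "{m}"]) auto

lemma monom_diff_add:
  assumes "Poly_Mapping.lookup m i \<noteq> 0"
  shows "(m + m') - Poly_Mapping.single i (1::nat) = (m - Poly_Mapping.single i 1) + m'"
  using assms
  by (intro poly_mapping_eqI) (auto simp: lookup_add lookup_minus lookup_single when_def)

lemma pd_mult_single:
  fixes c d :: "'k::field"
  shows "pd i (Poly_Mapping.single m c * Poly_Mapping.single m' d) =
     pd i (Poly_Mapping.single m c) * Poly_Mapping.single m' d +
     Poly_Mapping.single m c * pd i (Poly_Mapping.single m' d)"
proof -
  let ?e = "Poly_Mapping.single i (1::nat)"
  have 1: "Poly_Mapping.single ((m + m') - ?e) (of_nat (Poly_Mapping.lookup m i) * c * d) =
           Poly_Mapping.single ((m - ?e) + m') (of_nat (Poly_Mapping.lookup m i) * c * d)"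
    by (cases "Poly_Mapping.lookup m i = 0") (simp, subst monom_diff_add, assumption, rule refl)
  have 2: "Poly_Mapping.single ((m + m') - ?e) (c * (of_nat (Poly_Mapping.lookup m' i) * d)) =
           Poly_Mapping.single (m + (m' - ?e)) (c * (of_nat (Poly_Mapping.lookup m' i) * d))"
    by (cases "Poly_Mapping.lookup m' i = 0")
       (simp, subst add.commute, subst monom_diff_add, assumption, simp only: add.commute)
  have "pd i (Poly_Mapping.single m c * Poly_Mapping.single m' d) =
        Poly_Mapping.single ((m + m') - ?e) (of_nat (Poly_Mapping.lookup m i) * c * d) +
        Poly_Mapping.single ((m + m') - ?e) (c * (of_nat (Poly_Mapping.lookup m' i) * d))"
    by (simp add: mult_single pd_single lookup_add algebra_simps flip: single_add)
  then show ?thesis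
    unfolding 1 2 by (simp add: mult_single pd_single)
qed

lemma pd_mult: "pd i (p * q) = pd i p * q + p * pd i q"
proof -
  have dec: "p = (\<Sum>m\<in>Poly_Mapping.keys p. Poly_Mapping.single m (Poly_Mapping.lookup p m))"
    for p :: "'a mpol"
    by (intro poly_mapping_eqI) (auto simp: lookup_sum lookup_single when_def in_keys_iff)
  have "pd i ((\<Sum>m\<in>S. Poly_Mapping.single m (c m)) * (\<Sum>m\<in>T. Poly_Mapping.single m (d m))) =
      pd i (\<Sum>m\<in>S. Poly_Mapping.single m (c m)) * (\<Sum>m\<in>T. Poly_Mapping.single m (d m)) +
      (\<Sum>m\<in>S. Poly_Mapping.single m (c m)) * pd i (\<Sum>m\<in>T. Poly_Mapping.single m (d m))"
    for S T and c d :: "(nat \<Rightarrow>\<^sub>0 nat) \<Rightarrow> 'a"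
    unfolding sum_product pd_sum pd_mult_single sum.distrib ..
  from this[where S = "Poly_Mapping.keys p" and c = "Poly_Mapping.lookup p"
              and T = "Poly_Mapping.keys q" and d = "Poly_Mapping.lookup q"]
  show ?thesis
    by (simp only: flip: dec)
qed

text \<open>Extension of the partial derivatives to the field of fractions by the quotient rule.\<close>

lemma quotient_rule_welldef:
  fixes a b s t a' b' s' t' :: "'r::comm_ring_1"
  assumes e: "a * t = b * s" and d: "a' * t + a * t' = b' * s + b * s'"
  shows "(a' * s - a * s') * (t * t) = (b' * t - b * t') * (s * s)"
proof -
  have "(a' * s - a * s') * (t * t) = s * t * (a' * t) - s' * t * (a * t)"
    by (simp add: algebra_simps)
  also have "a' * t = b' * s + b * s' - a * t'"
    using d by (simp add: algebra_simps)
  also have "s * t * (b' * s + b * s' - a * t') - s' * t * (a * t) =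
             s * s * t * b' + s * t * b * s' - s * t' * (a * t) - s' * t * (a * t)"
    by (simp add: algebra_simps)
  also have "\<dots> = (b' * t - b * t') * (s * s)"
    unfolding e by (simp add: algebra_simps)
  finally show ?thesis .
qed

definition fpd :: "nat \<Rightarrow> 'k::field mpol fract \<Rightarrow> 'k mpol fract" where
  "fpd i q = (THE r. \<exists>a s. s \<noteq> 0 \<and> q = Fract a s \<and> r = Fract (pd i a * s - a * pd i s) (s * s))"

lemma fpd_Fract:
  assumes "s \<noteq> 0"
  shows "fpd i (Fract a s) = Fract (pd i a * s - a * pd i s) (s * s)"
  unfolding fpd_def
proof (rule the_equality)
  fix r assume "\<exists>b t. t \<noteq> 0 \<and> Fract a s = Fract b t \<and> r = Fract (pd i b * t - b * pd i t) (t * t)"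
  then obtain b t where t: "t \<noteq> 0" "Fract a s = Fract b t"
      and r: "r = Fract (pd i b * t - b * pd i t) (t * t)"
    by blast
  from t assms have e: "a * t = b * s" by (simp add: eq_fract)
  have d: "pd i a * t + a * pd i t = pd i b * s + b * pd i s"
    using arg_cong[OF e, of "pd i"] by (simp add: pd_mult)
  have "(pd i a * s - a * pd i s) * (t * t) = (pd i b * t - b * pd i t) * (s * s)"
    by (rule quotient_rule_welldef[OF e d])
  then show "r = Fract (pd i a * s - a * pd i s) (s * s)"
    using t(1) assms by (simp add: r eq_fract)
qed (use assms in blast)

lemma pd_1: "pd i 1 = 0"
  by (simp add: pd_single flip: single_one)

lemma fpd_of_pol: "fpd i (of_pol a) = of_pol (pd i a)"
  by (simp add: fpd_Fract pd_1)

lemma fpd_Const: "fpd i (of_pol (Const c)) = 0"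
  by (simp add: fpd_of_pol Const_def pd_single fract_collapse)

lemma fpd_add: "fpd i (f + g) = fpd i f + fpd i g"
proof -
  obtain a s where f: "f = Fract a s" "s \<noteq> 0" by (cases f)
  obtain b t where g: "g = Fract b t" "t \<noteq> 0" by (cases g)
  show ?thesis
    using f(2) g(2) unfolding f(1) g(1)
    by (simp add: fpd_Fract pd_mult pd_add eq_fract) (simp add: algebra_simps)
qed

lemma fpd_mult: "fpd i (f * g) = fpd i f * g + f * fpd i g"
proof -
  obtain a s where f: "f = Fract a s" "s \<noteq> 0" by (cases f)
  obtain b t where g: "g = Fract b t" "t \<noteq> 0" by (cases g)
  show ?thesis
    using f(2) g(2) unfolding f(1) g(1)
    by (simp add: fpd_Fract pd_mult eq_fract) (simp add: algebra_simps)
qed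


section \<open>The Poisson algebras\<close>

definition L_rel :: "nat \<Rightarrow> nat \<Rightarrow> 'k::field mpol" where
  "L_rel i j = (if j = i + 1 then xvar i * xvar j - 1
                else if odd (j - i) then xvar i * xvar j
                else - (xvar i * xvar j))"

definition L_gen :: "nat \<Rightarrow> nat \<Rightarrow> 'k::field mpol" where
  "L_gen i j = (if i < j then L_rel i j else if j < i then - L_rel j i else 0)"

text \<open>A bracket is determined, as a bilinear biderivation, by its values on the generators.\<close>

definition L_bracket :: "nat \<Rightarrow> 'k::field mpol \<Rightarrow> 'k mpol \<Rightarrow> 'k mpol" where
  "L_bracket n f g = (\<Sum>i=1..n. \<Sum>j=1..n. L_gen i j * pd i f * pd j g)"

definition L_fbracket :: "nat \<Rightarrow> 'k::field mpol fract \<Rightarrow> 'k mpol fract \<Rightarrow> 'k mpol fract" where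
  "L_fbracket n f g = (\<Sum>i=1..n. \<Sum>j=1..n. of_pol (L_gen i j) * fpd i f * fpd j g)"

lemma pd_xvar: "pd i (xvar j :: 'k::field mpol) = (if i = j then 1 else 0)"
  by (auto simp: xvar_def pd_single lookup_single single_diff)

lemma L_bracket_generators:
  assumes "i \<in> {1..n}" "j \<in> {1..n}"
  shows "L_bracket n (xvar i) (xvar j) = (L_gen i j :: 'k::field mpol)"
proof -
  have "L_bracket n (xvar i) (xvar j) =
        (\<Sum>a=1..n. \<Sum>b=1..n. if a = i then if b = j then L_gen a b else 0 else (0 :: 'k mpol))"
    unfolding L_bracket_def by (intro sum.cong refl) (simp add: pd_xvar)
  also have "\<dots> = (\<Sum>a=1..n. if a = i then L_gen a j else 0)"
    by (rule sum.cong) (use assms in \<open>auto\<close>)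
  also have "\<dots> = L_gen i j" using assms by auto
  finally show ?thesis .
qed

lemma L_gen_antisym: "L_gen i j = - L_gen j i"
  by (simp add: L_gen_def)

lemma L_bracket_add: "L_bracket n (f + g) h = L_bracket n f h + L_bracket n g h"
  by (simp add: L_bracket_def pd_add algebra_simps sum.distrib)

lemma L_bracket_Const: "L_bracket n (Const c) h = 0"
  by (simp add: L_bracket_def Const_def pd_single)

lemma L_bracket_Leibniz:
  "L_bracket n (f * g) h = f * L_bracket n g h + L_bracket n f h * g"
  by (simp add: L_bracket_def pd_mult algebra_simps sum.distrib sum_distrib_left)

lemma L_bracket_antisym: "L_bracket n f g = - L_bracket n g f"
  unfolding L_bracket_def
  by (subst sum.swap) (subst L_gen_antisym, simp add: algebra_simps sum_negf)

lemma of_pol_sum: "of_pol (sum f A) = (\<Sum>a\<in>A. of_pol (f a))"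
proof (induction A rule: infinite_finite_induct)
  case (insert a A)
  then show ?case by (simp flip: insert.IH)
qed (simp_all add: fract_collapse)

text \<open>So \<^const>\<open>L_fbracket\<close> extends \<^const>\<open>L_bracket\<close>; as a biderivation it is the only
  extension to a localization.\<close>

lemma L_fbracket_of_pol: "L_fbracket n (of_pol f) (of_pol g) = of_pol (L_bracket n f g)"
  by (simp add: L_fbracket_def L_bracket_def fpd_of_pol of_pol_sum)

lemma L_fbracket_add: "L_fbracket n (f + g) h = L_fbracket n f h + L_fbracket n g h"
  by (simp add: L_fbracket_def fpd_add algebra_simps sum.distrib)

lemma L_fbracket_Const: "L_fbracket n (of_pol (Const c)) h = 0"
  by (simp add: L_fbracket_def fpd_Const)

lemma L_fbracket_Leibniz:
  "L_fbracket n (f * g) h = f * L_fbracket n g h + L_fbracket n f h * g"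
  by (simp add: L_fbracket_def fpd_mult algebra_simps sum.distrib sum_distrib_left)

lemma L_fbracket_antisym: "L_fbracket n f g = - L_fbracket n g f"
proof -
  have *: "of_pol (L_gen i j) = - of_pol (L_gen j i :: 'a mpol)" for i j
    by (subst L_gen_antisym) simp
  show ?thesis
    unfolding L_fbracket_def
    by (subst sum.swap) (subst *, simp add: algebra_simps sum_negf del: minus_fract)
qed

text \<open>The convention \<open>z\<^sub>-\<^sub>1 = 0\<close> is only used for \<open>z\<^sub>1 = z\<^sub>0 x\<^sub>1 - z\<^sub>-\<^sub>1\<close>.\<close>

fun z :: "nat \<Rightarrow> 'k::field mpol" where
  "z 0 = 1"
| "z (Suc 0) = xvar 1"
| "z (Suc (Suc i)) = z (Suc i) * xvar (Suc (Suc i)) - z i"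

text \<open>The localization \<open>T\<^sub>L\<close> of \<open>F\<^sub>n\<close> at the multiplicative set generated by \<open>z\<^sub>1, \<dots>, z\<^sub>n\<close> is realized
  inside the field of fractions.\<close>

definition z_monoid :: "nat \<Rightarrow> 'k::field mpol set" where
  "z_monoid n = {\<Prod>i=1..n. z i ^ e i | e. True}"

definition T_L :: "nat \<Rightarrow> 'k::field mpol fract set" where
  "T_L n = {Fract f s | f s. f \<in> Fpoly n \<and> s \<in> z_monoid n}"

definition zf :: "nat \<Rightarrow> 'k::field mpol fract" where
  "zf i = of_pol (z i)"

definition base_field :: "'k::field mpol fract set" where
  "base_field = range (\<lambda>c. of_pol (Const c))"

text \<open>\<open>U\<close> as the subalgebra generated by \<open>z\<^sub>i\<^sup>\<plusminus>\<^sup>1\<close>, \<open>1 \<le> i \<le> n - 1\<close>.\<close>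

definition U_L :: "nat \<Rightarrow> 'k::field mpol fract set" where
  "U_L n = generate_ring (ring_on UNIV)
             (base_field \<union> zf ` {1..n-1} \<union> (\<lambda>i. inverse (zf i)) ` {1..n-1})"

text \<open>\<open>A = B[y\<^sup>\<plusminus>\<^sup>1]\<close>, the Laurent polynomial ring: evaluation at the unit \<open>y\<close> is a bijection
  from the Laurent polynomials with coefficients in \<open>B\<close> onto \<open>A\<close>.\<close>

definition laurent_eval :: "'f::field \<Rightarrow> (int \<Rightarrow>\<^sub>0 'f) \<Rightarrow> 'f" where
  "laurent_eval y p = (\<Sum>k\<in>Poly_Mapping.keys p. Poly_Mapping.lookup p k * y powi k)"

definition is_laurent_ring :: "'f::field set \<Rightarrow> 'f set \<Rightarrow> 'f \<Rightarrow> bool" where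
  "is_laurent_ring A B y \<longleftrightarrow> y \<noteq> 0 \<and>
     bij_betw (laurent_eval y) {p. \<forall>k. Poly_Mapping.lookup p k \<in> B} A"

end

theory Submission
  imports Defs
begin

text \<open>The \<open>z\<^sub>i\<close> are log-canonical: for \<open>i < j\<close>, \<open>{z\<^sub>i, z\<^sub>j} = z\<^sub>i z\<^sub>j\<close> if \<open>i\<close> is odd and \<open>j\<close> is even, and
  \<open>0\<close> otherwise. So every Laurent monomial in \<open>z\<^sub>1, \<dots>, z\<^sub>m\<close> is an eigenvector of the operators
  \<open>f \<mapsto> {f, z\<^sub>j} / z\<^sub>j\<close>, and for even \<open>m\<close> distinct monomials have distinct eigenvalues. A shortest nonzero
  element of a Poisson ideal is therefore a scalar times a monomial; this gives the simplicity
  statements, with scalars in \<open>K\<close> for even \<open>n\<close>, and \<open>z\<^sub>n - \<lambda> \<in> P\<close> for odd \<open>n\<close>, with scalars in \<open>K[z\<^sub>n]\<close>.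

  As \<open>{z\<^sub>i, x\<^sub>i\<^sub>+\<^sub>1}\<close> is \<open>z\<^sub>i\<^sub>+\<^sub>1\<close> or \<open>- z\<^sub>i\<^sub>-\<^sub>1\<close>, a Poisson prime ideal contains no \<open>z\<^sub>i\<close> with \<open>i < n\<close>. Modulo
  \<open>z\<^sub>n - \<lambda> = z\<^sub>n\<^sub>-\<^sub>1 x\<^sub>n - z\<^sub>n\<^sub>-\<^sub>2 - \<lambda>\<close> and up to a power of \<open>z\<^sub>n\<^sub>-\<^sub>1\<close> the variable \<open>x\<^sub>n\<close> can be eliminated, which
  reduces the classification to \<open>P \<inter> F\<^sub>n\<^sub>-\<^sub>1\<close>, a Poisson prime ideal of \<open>F\<^sub>n\<^sub>-\<^sub>1\<close>.\<close>

section \<open>Polynomials and partial derivatives\<close>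

text \<open>Characteristic 0 makes distinct integer weights distinct eigenvalues, and it turns
  \<open>p \<in> Fpoly n\<close> and questions of divisibility into statements about
  \<open>pd\<close>. Algebraic closedness serves to pick a linear factor z_n - c of a nonzero
  polynomial in z_n that lies in P. The weight matrix is skew-symmetric, hence degenerate for an odd
  number of indices. This is why for odd n just z_1, ..., z_(n-1) are inverted and the central
  element z_n is treated as a scalar. The x_i can still be recovered, because x_i = (z_i + z_(i-2))
  / z_(i-1) never divides by z_n. Eliminating x_n is a division whose remainder is free of x_n. It
  is conclusive because z_n - c is linear in x_n, so that no nonzero multiple of it is free of x_n.
  The price is a power of z_(n-1), and cancelling it is the delicate point: modulo z_n - c it takes
  the primality of z_(n-1), hence an induction on n; modulo the pair z_n, z_(n-1) - c the element
  z_(n-1) is congruent to the unit c.\<close>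

lemma Const_0 [simp]: "Const 0 = 0"
  by (simp add: Const_def)

lemma Const_1 [simp]: "Const 1 = 1"
  by (simp add: Const_def)

lemma Const_add: "Const (a + b) = Const a + Const b"
  by (simp add: Const_def single_add)

lemma Const_uminus: "Const (- a) = - Const a"
  by (simp add: Const_def single_uminus)

lemma Const_diff: "Const (a - b) = Const a - Const b"
  by (simp add: Const_def single_diff)

lemma Const_mult: "Const (a * b) = Const a * Const b"
  by (simp add: Const_def mult_single)

lemma Const_of_nat: "Const (of_nat k) = of_nat k"
  by (induction k) (simp_all add: Const_add)

lemma Const_eq_0_iff [simp]: "Const a = 0 \<longleftrightarrow> a = 0"
proof
  assume "Const a = 0"
  then have "Poly_Mapping.lookup (Const a) 0 = 0" by simp
  then show "a = 0" by (simp add: Const_def)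
qed simp

lemma pd_Const [simp]: "pd i (Const c) = 0"
  by (simp add: Const_def pd_single)

lemma pd_of_nat: "pd i (of_nat k) = 0"
  by (simp flip: Const_of_nat)

lemma pd_uminus: "pd i (- p) = - pd i p"
  using pd_add[of i p "- p"] by (simp add: pd_0 add_eq_0_iff)

lemma pd_diff: "pd i (p - q) = pd i p - pd i q"
  using pd_add[of i p "- q"] by (simp add: pd_uminus)

lemma single_xvar_split:
  assumes "Poly_Mapping.lookup m i \<noteq> 0"
  shows "Poly_Mapping.single m (c :: 'k::field) =
    xvar i * Poly_Mapping.single (m - Poly_Mapping.single i 1) c"
proof -
  have "m = Poly_Mapping.single i 1 + (m - Poly_Mapping.single i 1)"
    using assms by (intro poly_mapping_eqI) (auto simp: lookup_add lookup_minus lookup_single when_def)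
  then show ?thesis
    by (simp add: xvar_def mult_single)
qed

text \<open>Monomials are peeled off one variable at a time, by induction on the total degree. The
  set \<open>V\<close> is left arbitrary so that the rule serves F_n and the whole polynomial ring
  alike.\<close>

lemma mpol_induct [consumes 1, case_names Const xvar add mult]:
  fixes p :: "'k::field mpol"
  assumes "\<forall>m\<in>Poly_Mapping.keys p. Poly_Mapping.keys m \<subseteq> V"
    and Const: "\<And>c. P (Const c)" and xvar: "\<And>i. i \<in> V \<Longrightarrow> P (xvar i)"
    and add: "\<And>p q. P p \<Longrightarrow> P q \<Longrightarrow> P (p + q)" and mult: "\<And>p q. P p \<Longrightarrow> P q \<Longrightarrow> P (p * q)"
  shows "P p"
proof -
  have sing: "P (Poly_Mapping.single m c)" if "Poly_Mapping.keys m \<subseteq> V" for m c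
    using that
  proof (induction "\<Sum>i\<in>Poly_Mapping.keys m. Poly_Mapping.lookup m i" arbitrary: m rule: less_induct)
    case less
    show ?case
    proof (cases "m = 0")
      case True
      then show ?thesis using Const[of c] by (simp add: Const_def)
    next
      case False
      then obtain i where i: "i \<in> Poly_Mapping.keys m"
        by (metis keys_eq_empty equals0I)
      define m' where "m' = m - Poly_Mapping.single i 1"
      have lk: "Poly_Mapping.lookup m' j = (if j = i then Poly_Mapping.lookup m i - 1 else Poly_Mapping.lookup m j)" for j
        by (simp add: m'_def lookup_minus lookup_single when_def)
      have sub: "Poly_Mapping.keys m' \<subseteq> Poly_Mapping.keys m"
        by (auto simp: in_keys_iff lk split: if_splits)
      have "(\<Sum>j\<in>Poly_Mapping.keys m'. Poly_Mapping.lookup m' j) \<le> (\<Sum>j\<in>Poly_Mapping.keys m. Poly_Mapping.lookup m' j)"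
        by (rule sum_mono2) (use sub in auto)
      also have "\<dots> < (\<Sum>j\<in>Poly_Mapping.keys m. Poly_Mapping.lookup m j)"
        by (rule sum_strict_mono_ex1) (use i in \<open>auto simp: lk in_keys_iff intro!: bexI[of _ i]\<close>)
      finally have "P (Poly_Mapping.single m' c)"
        using less.hyps less.prems sub by blast
      moreover have "Poly_Mapping.single m c = xvar i * Poly_Mapping.single m' c"
        unfolding m'_def by (rule single_xvar_split) (use i in \<open>simp add: in_keys_iff\<close>)
      ultimately show ?thesis
        using mult xvar i less.prems by auto
    qed
  qed
  have dec: "p = (\<Sum>m\<in>Poly_Mapping.keys p. Poly_Mapping.single m (Poly_Mapping.lookup p m))"
    by (intro poly_mapping_eqI) (auto simp: lookup_sum lookup_single when_def in_keys_iff)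
  have "P (\<Sum>m\<in>S. Poly_Mapping.single m (Poly_Mapping.lookup p m))" if "S \<subseteq> Poly_Mapping.keys p" "finite S" for S
    using that(2,1)
  proof (induction S rule: finite_induct)
    case empty
    then show ?case using Const[of 0] by simp
  next
    case (insert m S)
    then show ?case using add sing assms(1) by auto
  qed
  from this[of "Poly_Mapping.keys p"] show ?thesis
    using dec by simp
qed

text \<open>Reading the derivative at a fixed target monomial shifts exponents upwards, which
  removes the truncated subtraction from \<open>pd_def\<close>.\<close>

lemma lookup_pd:
  fixes p :: "'k::field mpol"
  shows "Poly_Mapping.lookup (pd i p) m =
    of_nat (Suc (Poly_Mapping.lookup m i)) * Poly_Mapping.lookup p (m + Poly_Mapping.single i 1)"
proof -
  have eq: "Poly_Mapping.lookup (Poly_Mapping.single (m' - Poly_Mapping.single i 1) (of_nat (Poly_Mapping.lookup m' i) * c)) m =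
     (if m' = m + Poly_Mapping.single i 1 then of_nat (Suc (Poly_Mapping.lookup m i)) * c else 0)"
    (is "?l = ?r") for m' and c :: 'k
  proof (cases "Poly_Mapping.lookup m' i = 0")
    case True
    then have "m' \<noteq> m + Poly_Mapping.single i 1"
      by (auto simp: lookup_add)
    then show ?thesis using True by simp
  next
    case False
    then have "m' = (m' - Poly_Mapping.single i 1) + Poly_Mapping.single i 1"
      by (intro poly_mapping_eqI) (auto simp: lookup_add lookup_minus lookup_single when_def)
    then have "m' - Poly_Mapping.single i 1 = m \<longleftrightarrow> m' = m + Poly_Mapping.single i 1"
      by (metis add_diff_cancel_right')
    then show ?thesis
      by (auto simp: lookup_single lookup_add when_def)
  qed
  have "Poly_Mapping.lookup (pd i p) m = (\<Sum>m'\<in>Poly_Mapping.keys p.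
     if m' = m + Poly_Mapping.single i 1 then of_nat (Suc (Poly_Mapping.lookup m i)) * Poly_Mapping.lookup p m' else 0)"
    unfolding pd_def lookup_sum by (intro sum.cong refl eq)
  also have "\<dots> = of_nat (Suc (Poly_Mapping.lookup m i)) * Poly_Mapping.lookup p (m + Poly_Mapping.single i 1)"
    by (simp add: in_keys_iff)
  finally show ?thesis .
qed

lemma pd_funpow_eq_0:
  assumes "\<And>m. m \<in> Poly_Mapping.keys p \<Longrightarrow> Poly_Mapping.lookup m i < N"
  shows "(pd i ^^ N) p = 0"
  using assms
proof (induction N arbitrary: p)
  case 0
  then have "Poly_Mapping.keys p = {}" by (auto simp del: keys_eq_empty)
  then show ?case by simp
next
  case (Suc N)
  have "Poly_Mapping.lookup m i < N" if "m \<in> Poly_Mapping.keys (pd i p)" for m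
  proof -
    have "m + Poly_Mapping.single i 1 \<in> Poly_Mapping.keys p"
      using that by (auto simp: in_keys_iff lookup_pd)
    from Suc.prems[OF this] show ?thesis by (simp add: lookup_add)
  qed
  from Suc.IH[OF this] show ?case
    by (simp add: funpow_swap1)
qed

lemma pd_locally_nilpotent: "\<exists>N. (pd i ^^ N) p = 0"
proof -
  let ?S = "(\<lambda>m. Poly_Mapping.lookup m i) ` Poly_Mapping.keys p"
  have "Poly_Mapping.lookup m i < Suc (Max ?S)" if "m \<in> Poly_Mapping.keys p" for m
    using that by (auto simp: less_Suc_eq_le intro!: Max_ge)
  from pd_funpow_eq_0[OF this] show ?thesis by blast
qed

text \<open>By \<open>lookup_pd\<close> the coefficient of \<open>m\<close> reappears in
  \<open>pd i p\<close> with the factor \<open>Poly_Mapping.lookup m i\<close>, which is nonzero in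
  characteristic 0 if \<open>x\<^sub>i\<close> occurs.\<close>

lemma pd_eq_0_imp_lookup_0:
  fixes p :: "'k::field_char_0 mpol"
  assumes "pd i p = 0" "m \<in> Poly_Mapping.keys p"
  shows "Poly_Mapping.lookup m i = 0"
proof (rule ccontr)
  assume *: "Poly_Mapping.lookup m i \<noteq> 0"
  let ?m = "m - Poly_Mapping.single i 1"
  have "?m + Poly_Mapping.single i 1 = m"
    using * by (intro poly_mapping_eqI) (auto simp: lookup_add lookup_minus lookup_single when_def)
  then have "of_nat (Suc (Poly_Mapping.lookup ?m i)) * Poly_Mapping.lookup p m = 0"
    using lookup_pd[of i p ?m] assms(1) by simp
  then show False
    using assms(2) by (simp add: in_keys_iff del: of_nat_Suc)
qed

lemma pd_eq_0_of_not_mem: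
  assumes "p \<in> Fpoly n" "i \<notin> {1..n}"
  shows "pd i p = 0"
proof (rule poly_mapping_eqI)
  fix m
  have "m + Poly_Mapping.single i 1 \<notin> Poly_Mapping.keys p"
  proof
    assume "m + Poly_Mapping.single i 1 \<in> Poly_Mapping.keys p"
    then have "Poly_Mapping.keys (m + Poly_Mapping.single i 1) \<subseteq> {1..n}"
      using assms(1) by (auto simp: Fpoly_def)
    moreover have "i \<in> Poly_Mapping.keys (m + Poly_Mapping.single i 1)"
      by (simp add: in_keys_iff lookup_add)
    ultimately show False using assms(2) by blast
  qed
  then show "Poly_Mapping.lookup (pd i p) m = Poly_Mapping.lookup 0 m"
    by (simp add: lookup_pd in_keys_iff)
qed

text \<open>This description of F_n is compatible with the Leibniz rule, unlike the one by supports;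
  it is what lets factors be pulled out of F_n in \<open>Fpoly_cancel\<close>.\<close>

lemma Fpoly_iff_pd:
  fixes p :: "'k::field_char_0 mpol"
  shows "p \<in> Fpoly n \<longleftrightarrow> (\<forall>i. i \<notin> {1..n} \<longrightarrow> pd i p = 0)"
proof
  assume *: "\<forall>i. i \<notin> {1..n} \<longrightarrow> pd i p = 0"
  have "i \<in> {1..n}" if "m \<in> Poly_Mapping.keys p" "i \<in> Poly_Mapping.keys m" for m i
    using pd_eq_0_imp_lookup_0[of i p m] that * by (auto simp: in_keys_iff)
  then show "p \<in> Fpoly n" unfolding Fpoly_def by blast
qed (blast intro: pd_eq_0_of_not_mem)

section \<open>Closure properties of F_n\<close>

lemma Fpoly_Const [simp, intro]: "Const c \<in> Fpoly n"
  by (auto simp: Fpoly_def Const_def)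

lemma Fpoly_0 [simp, intro]: "0 \<in> Fpoly n"
  by (auto simp: Fpoly_def)

lemma Fpoly_1 [simp, intro]: "1 \<in> Fpoly n"
  using Fpoly_Const[of 1] by simp

lemma Fpoly_xvar [intro]: "i \<in> {1..n} \<Longrightarrow> xvar i \<in> Fpoly n"
  by (auto simp: Fpoly_def xvar_def)

lemma Fpoly_add [intro]: "p \<in> Fpoly n \<Longrightarrow> q \<in> Fpoly n \<Longrightarrow> p + q \<in> Fpoly n"
  using Poly_Mapping.keys_add[of p q] by (fastforce simp: Fpoly_def)

lemma Fpoly_uminus [intro]: "p \<in> Fpoly n \<Longrightarrow> - p \<in> Fpoly n"
  by (auto simp: Fpoly_def)

lemma Fpoly_diff [intro]: "p \<in> Fpoly n \<Longrightarrow> q \<in> Fpoly n \<Longrightarrow> p - q \<in> Fpoly n"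
  using Fpoly_add[of p n "- q"] by auto

lemma Fpoly_mult [intro]:
  assumes "p \<in> Fpoly n" "q \<in> Fpoly n" shows "p * q \<in> Fpoly n"
  unfolding Fpoly_def
proof safe
  fix m i assume "m \<in> Poly_Mapping.keys (p * q)" and i: "i \<in> Poly_Mapping.keys m"
  then obtain a b where ab: "m = a + b" "a \<in> Poly_Mapping.keys p" "b \<in> Poly_Mapping.keys q"
    using Poly_Mapping.keys_mult[of p q] by blast
  then have "i \<in> Poly_Mapping.keys a \<or> i \<in> Poly_Mapping.keys b"
    using i Poly_Mapping.keys_add[of a b] by blast
  then show "i \<in> {1..n}" using ab assms unfolding Fpoly_def by blast
qed

lemma Fpoly_power [intro]: "p \<in> Fpoly n \<Longrightarrow> p ^ k \<in> Fpoly n"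
  by (induction k) auto

lemma Fpoly_sum [intro]: "(\<And>a. a \<in> A \<Longrightarrow> f a \<in> Fpoly n) \<Longrightarrow> sum f A \<in> Fpoly n"
  by (induction A rule: infinite_finite_induct) auto

lemma Fpoly_prod [intro]: "(\<And>a. a \<in> A \<Longrightarrow> f a \<in> Fpoly n) \<Longrightarrow> prod f A \<in> Fpoly n"
  by (induction A rule: infinite_finite_induct) auto

lemma Fpoly_mono: "m \<le> n \<Longrightarrow> Fpoly m \<subseteq> Fpoly n"
  unfolding Fpoly_def by fastforce

lemma Fpoly_induct [consumes 1, case_names Const xvar add mult]:
  assumes "p \<in> Fpoly n"
    and "\<And>c. P (Const c)" and "\<And>i. i \<in> {1..n} \<Longrightarrow> P (xvar i)"
    and "\<And>p q. P p \<Longrightarrow> P q \<Longrightarrow> P (p + q)" and "\<And>p q. P p \<Longrightarrow> P q \<Longrightarrow> P (p * q)"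
  shows "P p"
  using assms by (intro mpol_induct[of p "{1..n}" P]) (auto simp: Fpoly_def)

lemma Fpoly_pd [intro]:
  assumes "p \<in> Fpoly n" shows "pd i p \<in> Fpoly n"
  unfolding Fpoly_def
proof (intro CollectI ballI)
  fix m assume "m \<in> Poly_Mapping.keys (pd i p)"
  then have "m + Poly_Mapping.single i 1 \<in> Poly_Mapping.keys p"
    by (auto simp: in_keys_iff lookup_pd)
  then have "Poly_Mapping.keys (m + Poly_Mapping.single i 1) \<subseteq> {1..n}"
    using assms unfolding Fpoly_def by blast
  moreover have "Poly_Mapping.keys m \<subseteq> Poly_Mapping.keys (m + Poly_Mapping.single i 1)"
    by (auto simp: in_keys_iff lookup_add)
  ultimately show "Poly_Mapping.keys m \<subseteq> {1..n}" by blast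
qed

text \<open>For a variable outside F_n the Leibniz rule leaves \<open>p * pd i q = 0\<close> in a
  domain. The lemma links \<open>dvd\<close>, which refers to the ambient polynomial ring, with
  ideals of F_n.\<close>

lemma Fpoly_cancel:
  fixes p :: "'k::field_char_0 mpol"
  assumes "p * q \<in> Fpoly n" "p \<in> Fpoly n" "p \<noteq> 0"
  shows "q \<in> Fpoly n"
  unfolding Fpoly_iff_pd
proof safe
  fix i assume "i \<notin> {1..n}"
  then have "pd i (p * q) = 0" "pd i p = 0"
    using assms pd_eq_0_of_not_mem by blast+
  then show "pd i q = 0" using assms(3) by (simp add: pd_mult)
qed

text \<open>In the higher Leibniz formula only the two terms with at most one derivative on
  \<open>l\<close> survive.\<close>

lemma funpow_pd_mult_linear:
  assumes "pd i (pd i l) = 0"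
  shows "(pd i ^^ Suc k) (l * q) = l * (pd i ^^ Suc k) q + of_nat (Suc k) * (pd i l * (pd i ^^ k) q)"
proof (induction k)
  case 0
  then show ?case by (simp add: pd_mult)
next
  case (Suc k)
  have "(pd i ^^ Suc (Suc k)) (l * q) = pd i ((pd i ^^ Suc k) (l * q))" by simp
  also have "\<dots> = pd i (l * (pd i ^^ Suc k) q + of_nat (Suc k) * (pd i l * (pd i ^^ k) q))"
    by (simp only: Suc.IH)
  also have "\<dots> = l * (pd i ^^ Suc (Suc k)) q + of_nat (Suc (Suc k)) * (pd i l * (pd i ^^ Suc k) q)"
    using assms by (simp add: pd_add pd_mult pd_of_nat pd_1 pd_0 algebra_simps)
  finally show ?case .
qed

text \<open>An element linear in \<open>x\<^sub>i\<close> divides no nonzero element free of \<open>x\<^sub>i\<close>, modulo any \<open>\<pi>\<close> that is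
  free of \<open>x\<^sub>i\<close>: apply powers of \<open>\<partial>\<^sub>i\<close> and use that it is locally nilpotent. The case \<open>\<pi> = 0\<close> is
  the one without a modulus.\<close>

lemma dvd_of_dvd_linear_mult_diff:
  fixes l :: "'k::field_char_0 mpol"
  assumes d: "\<pi> dvd l * q - r"
    and pi: "pd i \<pi> = 0" and r: "pd i r = 0" and l: "pd i (pd i l) = 0"
    and reg: "\<And>b. \<pi> dvd pd i l * b \<Longrightarrow> \<pi> dvd b"
  shows "\<pi> dvd q" "\<pi> dvd r"
proof -
  have pres: "\<pi> dvd (pd i ^^ k) f" if "\<pi> dvd f" for f k
  proof (induction k)
    case (Suc k)
    then obtain g where "(pd i ^^ k) f = \<pi> * g" by blast
    then show ?case by (simp add: pd_mult pi)
  qed (use that in simp)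
  show q: "\<pi> dvd q"
  proof (rule ccontr)
    assume n: "\<not> \<pi> dvd q"
    obtain N where "(pd i ^^ N) q = 0" using pd_locally_nilpotent by blast
    then have ex: "\<exists>N. \<pi> dvd (pd i ^^ N) q" by (metis dvd_0_right)
    \<comment> \<open>\<open>M\<close> is the first order at which the derivative of
      \<open>q\<close> becomes divisible by \<open>\<pi>\<close>; the derivative one order below is
      not divisible, and the contradiction will be that it is.\<close>
    define M where "M = (LEAST N. \<pi> dvd (pd i ^^ N) q)"
    have M: "\<pi> dvd (pd i ^^ M) q" unfolding M_def using ex by (rule LeastI_ex)
    then have "M \<noteq> 0" using n by (metis funpow_0)
    then obtain k where k: "M = Suc k" by (cases M) auto
    have nk: "\<not> \<pi> dvd (pd i ^^ k) q"
      using not_less_Least[of k "\<lambda>N. \<pi> dvd (pd i ^^ N) q"] k by (simp add: M_def)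
    have "(pd i ^^ Suc k) (f - r) = (pd i ^^ Suc k) f" for f
      unfolding funpow_Suc_right by (simp add: pd_diff r)
    then have "\<pi> dvd (pd i ^^ Suc k) (l * q)"
      using pres[OF d, of "Suc k"] by simp
    \<comment> \<open>In the formula for the derivative of order \<open>Suc k\<close> the summand
      with \<open>l\<close> is divisible by the choice of \<open>M\<close>; what remains carries the
      factor \<open>Suc k\<close>, a unit in characteristic 0.\<close>
    then have "\<pi> dvd of_nat (Suc k) * (pd i l * (pd i ^^ k) q)"
      using M unfolding funpow_pd_mult_linear[OF l] k by (metis dvd_add_right_iff dvd_mult)
    then have "\<pi> dvd Const (inverse (of_nat (Suc k))) * (of_nat (Suc k) * (pd i l * (pd i ^^ k) q))"
      by (rule dvd_mult)
    also have "\<dots> = Const (inverse (of_nat (Suc k)) * of_nat (Suc k)) * (pd i l * (pd i ^^ k) q)"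
      unfolding Const_mult Const_of_nat by (simp only: mult.assoc)
    also have "\<dots> = pd i l * (pd i ^^ k) q"
      by (subst left_inverse) (simp_all del: of_nat_Suc)
    finally show False using reg nk by blast
  qed
  then have "\<pi> dvd l * q" by simp
  from dvd_diff[OF this d] show "\<pi> dvd r" by simp
qed

section \<open>Brackets of the elements \<open>z\<^sub>i\<close>\<close>

lemma L_gen_Fpoly [intro]:
  assumes "i \<in> {1..n}" "j \<in> {1..n}"
  shows "L_gen i j \<in> Fpoly n"
  unfolding L_gen_def L_rel_def using assms
  by (auto intro!: Fpoly_diff Fpoly_mult Fpoly_uminus Fpoly_xvar)

lemma L_bracket_Fpoly [intro]:
  assumes "f \<in> Fpoly n" "g \<in> Fpoly n"
  shows "L_bracket n f g \<in> Fpoly n"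
  unfolding L_bracket_def using assms by (intro Fpoly_sum Fpoly_mult L_gen_Fpoly Fpoly_pd)

lemma z_Fpoly: "(z i :: 'k::field mpol) \<in> Fpoly i"
proof (induction i rule: z.induct)
  case (3 i)
  have "(z i :: 'k mpol) \<in> Fpoly (Suc (Suc i))"
    by (rule subsetD[OF Fpoly_mono, rotated], rule 3) simp
  moreover have "(z (Suc i) :: 'k mpol) \<in> Fpoly (Suc (Suc i))"
    by (rule subsetD[OF Fpoly_mono, rotated], rule 3) simp
  ultimately show ?case by (auto intro!: Fpoly_diff Fpoly_mult Fpoly_xvar)
qed (auto intro!: Fpoly_xvar)

lemma z_Fpoly_le [simp, intro]: "i \<le> n \<Longrightarrow> z i \<in> Fpoly n"
  using z_Fpoly Fpoly_mono by blast

lemma pd_z_eq_0: "i < j \<Longrightarrow> pd j (z i) = 0"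
  using z_Fpoly by (rule pd_eq_0_of_not_mem) simp

text \<open>Thus z_(i+1) is linear in x_(i+1) with leading coefficient z_i, the fact on which every
  elimination rests.\<close>

lemma pd_z_Suc_self: "pd (Suc i) (z (Suc i)) = z i"
proof (cases i)
  case (Suc k)
  then show ?thesis by (simp add: pd_diff pd_mult pd_xvar pd_z_eq_0)
qed (simp add: pd_xvar)

lemma z_nonzero [simp]: "z i \<noteq> 0"
proof (induction i)
  case (Suc i)
  then show ?case using pd_z_Suc_self[of i] by (metis pd_0)
qed simp

lemma L_bracket_diff: "L_bracket n (f - g) h = L_bracket n f h - L_bracket n g h"
  by (simp add: L_bracket_def pd_diff algebra_simps sum_subtractf)

lemma L_bracket_diff_right: "L_bracket n h (f - g) = L_bracket n h f - L_bracket n h g"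
  by (simp add: L_bracket_def pd_diff algebra_simps sum_subtractf)

lemma L_bracket_one_right [simp]: "L_bracket n h 1 = 0"
  by (simp add: L_bracket_def pd_1)

lemma L_bracket_Leibniz_right:
  "L_bracket n h (f * g) = f * L_bracket n h g + L_bracket n h f * g"
  by (simp add: L_bracket_def pd_mult algebra_simps sum.distrib sum_distrib_left)

text \<open>At \<open>i = 0\<close> the even case of \<open>j = i + 1\<close> reads \<open>- z\<^sub>-\<^sub>1 = 0\<close>.\<close>

lemma L_bracket_z_xvar:
  assumes "i \<le> n" "j \<in> {1..n}"
  shows "L_bracket n (z i) (xvar j :: 'k::field mpol) =
    (if i < j
     then if j = Suc i then if odd i then z (Suc i) else if i = 0 then 0 else - z (i - 1)
          else if odd i then (if even j then z i * xvar j else - (z i * xvar j)) else 0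
     else if odd i then 0 else if even j then z i * xvar j else - (z i * xvar j))"
  using assms(1)
proof (induction i rule: z.induct)
  case 1
  then show ?case using assms(2) by (simp add: L_bracket_def pd_1)
next
  case 2
  have "L_bracket n (xvar 1) (xvar j :: 'k mpol) = L_gen 1 j"
    using 2 assms by (intro L_bracket_generators) auto
  moreover consider "j = 1" | "j = Suc 1" | "j > Suc 1" using assms(2) by force
  ultimately show ?case
    by cases (auto simp: L_gen_def L_rel_def)
next
  case (3 i)
  let ?B = "\<lambda>i. L_bracket n (z i) (xvar j :: 'k mpol)"
  have gen: "L_bracket n (xvar (Suc (Suc i))) (xvar j :: 'k mpol) = L_gen (Suc (Suc i)) j"
    using 3 assms by (intro L_bracket_generators) auto
  have step: "?B (Suc (Suc i)) = z (Suc i) * L_gen (Suc (Suc i)) j + ?B (Suc i) * xvar (Suc (Suc i)) - ?B i"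
    by (simp add: L_bracket_diff L_bracket_Leibniz gen)
  note IH = "3.IH"(1)[OF Suc_leD[OF "3.prems"]] "3.IH"(2)[OF Suc_leD[OF Suc_leD[OF "3.prems"]]]
  \<comment> \<open>The three middle values of \<open>j\<close> are those at which an adjacent pair
    of indices, and with it the constant - 1 or an exceptional value of the induction hypothesis,
    enters the recursion.\<close>
  consider "j > Suc (Suc (Suc i))" | "j = Suc (Suc (Suc i))" | "j = Suc (Suc i)" | "j = Suc i" | "j \<le> i"
    by linarith
  then show ?case
  proof cases
    case 1
    then show ?thesis unfolding step IH by (auto simp: L_gen_def L_rel_def algebra_simps)
  next
    case 2
    then show ?thesis unfolding step IH by (auto simp: L_gen_def L_rel_def algebra_simps)
  next
    case 3
    then show ?thesis unfolding step IH by (auto simp: L_gen_def L_rel_def algebra_simps)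
  next
    case 4
    then show ?thesis unfolding step IH
      by (cases i) (auto simp: L_gen_def L_rel_def algebra_simps)
  next
    case 5
    then show ?thesis unfolding step IH using assms(2)
      by (auto simp: L_gen_def L_rel_def algebra_simps)
  qed
qed

definition z_weight :: "nat \<Rightarrow> nat \<Rightarrow> int" where
  "z_weight i j = (if i < j \<and> odd i \<and> even j then 1 else if j < i \<and> odd j \<and> even i then - 1 else 0)"

text \<open>Against x_i with i \<le> j the element z_j has a pure weight: 0 for odd j, and for even
  j it is +1 or -1 as i is even or odd. The recursion is homogeneous for these weights, so z_i
  inherits weight -1 or 0.\<close>

lemma L_bracket_z_z_le:
  assumes "i \<le> j" "j \<le> n"
  shows "L_bracket n (z j) (z i :: 'k::field mpol) = (if even j \<and> odd i then - (z j * z i) else 0)"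
  using assms(1)
proof (induction i rule: z.induct)
  case 1
  then show ?case by simp
next
  case 2
  then show ?case using L_bracket_z_xvar[of j n 1] assms(2) by auto
next
  case (3 i)
  have "L_bracket n (z j) (xvar (Suc (Suc i)) :: 'k mpol) =
     (if odd j then 0 else if even i then z j * xvar (Suc (Suc i)) else - (z j * xvar (Suc (Suc i))))"
    using L_bracket_z_xvar[of j n "Suc (Suc i)"] 3 assms(2) by auto
  with 3 show ?case
    by (simp add: L_bracket_diff_right L_bracket_Leibniz_right) (simp add: algebra_simps)
qed

lemma L_bracket_z_z:
  assumes "i \<le> n" "j \<le> n"
  shows "L_bracket n (z i) (z j :: 'k::field mpol) = of_int (z_weight i j) * z i * z j"
proof (cases "j \<le> i")
  case True
  then show ?thesis using L_bracket_z_z_le[OF True assms(1)]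
    by (auto simp: z_weight_def)
next
  case False
  then have "L_bracket n (z i) (z j :: 'k mpol) = - (if even j \<and> odd i then - (z j * z i) else 0)"
    using L_bracket_z_z_le[of i j n] assms by (subst L_bracket_antisym) simp
  then show ?thesis using False by (auto simp: z_weight_def)
qed

lemma L_bracket_expand_right:
  "L_bracket n f g = (\<Sum>j=1..n. L_bracket n f (xvar j) * pd j g)"
proof -
  have "(\<Sum>j=1..n. L_bracket n f (xvar j) * pd j g) =
      (\<Sum>j=1..n. (\<Sum>i=1..n. L_gen i j * pd i f) * pd j g)"
  proof (rule sum.cong[OF refl])
    fix j assume j: "j \<in> {1..n}"
    have "L_bracket n f (xvar j) = (\<Sum>i=1..n. \<Sum>k=1..n. if k = j then L_gen i j * pd i f else 0)"
      unfolding L_bracket_def by (intro sum.cong refl) (auto simp: pd_xvar)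
    also have "\<dots> = (\<Sum>i=1..n. L_gen i j * pd i f)"
      using j by simp
    finally show "L_bracket n f (xvar j) * pd j g = (\<Sum>i=1..n. L_gen i j * pd i f) * pd j g" by simp
  qed
  also have "\<dots> = L_bracket n f g"
    unfolding L_bracket_def sum_distrib_right by (rule sum.swap)
  finally show ?thesis by simp
qed

text \<open>F_n has no variable beyond x_n, so only the last branch of
  \<open>L_bracket_z_xvar\<close> occurs: z_n is central for odd n and normal for even n. Hence the
  ideals generated by z_n, and by z_n - c for odd n, are closed under the bracket.\<close>

lemma L_bracket_z_self:
  fixes g :: "'k::field mpol"
  assumes "g \<in> Fpoly n"
  shows "odd n \<Longrightarrow> L_bracket n (z n) g = 0"
    and "\<exists>h\<in>Fpoly n. L_bracket n (z n) g = h * z n"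
proof -
  show "L_bracket n (z n) g = 0" if "odd n"
    unfolding L_bracket_expand_right[of n "z n" g]
    by (rule sum.neutral) (use that in \<open>auto simp: L_bracket_z_xvar\<close>)
  have "L_bracket n (z n) g = (\<Sum>j=1..n. (if odd n then 0 else if even j then xvar j else - xvar j) * pd j g) * z n"
    unfolding L_bracket_expand_right[of n "z n" g] sum_distrib_right
    by (rule sum.cong) (auto simp: L_bracket_z_xvar)
  moreover have "(\<Sum>j=1..n. (if odd n then 0 else if even j then xvar j else - xvar j) * pd j g) \<in> Fpoly n"
    using assms by (intro Fpoly_sum Fpoly_mult Fpoly_pd) (auto intro!: Fpoly_xvar Fpoly_uminus)
  ultimately show "\<exists>h\<in>Fpoly n. L_bracket n (z n) g = h * z n" by blast
qed

lemma L_bracket_restrict: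
  assumes "f \<in> Fpoly m" "g \<in> Fpoly m" "m \<le> n"
  shows "L_bracket n f g = L_bracket m f g"
proof -
  have "L_bracket n f g = (\<Sum>i=1..n. \<Sum>j=1..m. L_gen i j * pd i f * pd j g)"
    unfolding L_bracket_def
    by (intro sum.cong refl sum.mono_neutral_right) (use assms in \<open>auto simp: pd_eq_0_of_not_mem\<close>)
  also have "\<dots> = L_bracket m f g"
    unfolding L_bracket_def
    by (intro sum.mono_neutral_right) (use assms in \<open>auto simp: pd_eq_0_of_not_mem\<close>)
  finally show ?thesis .
qed

section \<open>Prime elements\<close>

text \<open>The elements \<open>z\<^sub>n - c\<close> that generate Poisson prime ideals of \<open>F\<^sub>n\<close>; the exceptions avoided here
  include \<open>z\<^sub>2 + 1 = x\<^sub>1 x\<^sub>2\<close>.\<close>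

definition z_admissible :: "nat \<Rightarrow> 'k::field \<Rightarrow> bool" where
  "z_admissible n c \<longleftrightarrow> odd n \<or> n > 0 \<and> c = 0"

text \<open>Modulo z_(n+1) - c the variable x_(n+1) equals (z_(n-1) + c) / z_n, and a power of z_n
  clears the denominators. \<open>V\<close> will be \<open>UNIV\<close> for divisibility in the
  ambient ring and \<open>{1..Suc n}\<close> for F_(n+1).\<close>

lemma z_pred_division:
  fixes f :: "'k::field mpol"
  assumes "\<forall>m\<in>Poly_Mapping.keys f. Poly_Mapping.keys m \<subseteq> V" and V: "{1..Suc n} \<subseteq> V"
  shows "\<exists>k q r. z n ^ k * f = (z (Suc n) - Const c) * q + r \<and> (\<forall>i. i \<notin> V - {Suc n} \<longrightarrow> pd i r = 0)"
  using assms(1)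
proof (induction rule: mpol_induct)
  case (Const a)
  show ?case
    by (rule exI[of _ 0], rule exI[of _ 0], rule exI[of _ "Const a"]) simp
next
  case (xvar j)
  show ?case
  proof (cases "j = Suc n")
    case False
    with xvar show ?thesis
      by (intro exI[of _ 0] exI[of _ "xvar j"]) (auto simp: pd_xvar)
  next
    case True
    \<comment> \<open>The numerator z_(n-1) + c, read with z_(-1) = 0 when
      \<open>n = 0\<close>.\<close>
    define w where "w = (if n = 0 then Const c else z (n - 1) + Const c)"
    have "w \<in> Fpoly n" unfolding w_def by (auto intro!: Fpoly_add)
    then have "pd i w = 0" if "i \<notin> V - {Suc n}" for i
      by (rule pd_eq_0_of_not_mem) (use that subsetD[OF V, of i] in auto)
    moreover have "z n ^ 1 * xvar j = (z (Suc n) - Const c) * 1 + w"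
      using True by (cases n) (auto simp: w_def)
    ultimately show ?thesis by blast
  qed
next
  case (add f g)
  then obtain k q r l q' r' where
    *: "z n ^ k * f = (z (Suc n) - Const c) * q + r" "\<forall>i. i \<notin> V - {Suc n} \<longrightarrow> pd i r = 0"
       "z n ^ l * g = (z (Suc n) - Const c) * q' + r'" "\<forall>i. i \<notin> V - {Suc n} \<longrightarrow> pd i r' = 0" by blast
  have "z n ^ (k + l) * (f + g) = z n ^ l * (z n ^ k * f) + z n ^ k * (z n ^ l * g)"
    by (simp add: power_add algebra_simps)
  also have "\<dots> = (z (Suc n) - Const c) * (z n ^ l * q + z n ^ k * q') + (z n ^ l * r + z n ^ k * r')"
    unfolding * by (simp add: algebra_simps)
  finally have eq: "z n ^ (k + l) * (f + g) = \<dots>" .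
  have pz: "pd i (z n ^ a) = 0" if "i \<notin> V - {Suc n}" for i a
    by (rule pd_eq_0_of_not_mem[of _ n]) (use that subsetD[OF V, of i] in auto)
  show ?case
    by (intro exI conjI) (rule eq, use * in \<open>simp add: pd_add pd_mult pz\<close>)
next
  case (mult f g)
  then obtain k q r l q' r' where
    *: "z n ^ k * f = (z (Suc n) - Const c) * q + r" "\<forall>i. i \<notin> V - {Suc n} \<longrightarrow> pd i r = 0"
       "z n ^ l * g = (z (Suc n) - Const c) * q' + r'" "\<forall>i. i \<notin> V - {Suc n} \<longrightarrow> pd i r' = 0" by blast
  have "z n ^ (k + l) * (f * g) = (z n ^ k * f) * (z n ^ l * g)"
    by (simp add: power_add algebra_simps)
  also have "\<dots> = (z (Suc n) - Const c) * (q * (z n ^ l * g) + r * q') + r * r'"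
    unfolding * by (simp add: algebra_simps)
  finally show ?case
    by (intro exI conjI) (assumption, use * in \<open>auto simp: pd_mult\<close>)
qed

text \<open>Two factors of a multiple of z_(n+1) - c are replaced by their remainders, which are
  free of x_(n+1). The product of the remainders is again a multiple, hence 0, so one remainder
  vanishes. The power of z_n in front of that factor is cancelled since z_n is prime by induction,
  with constant 0, and does not divide z_(n+1) - c.\<close>

lemma prime_elem_z_diff_Const:
  fixes c :: "'k::field_char_0"
  assumes "z_admissible n c"
  shows "prime_elem (z n - Const c)"
  using assms
proof (induction n arbitrary: c)
  case 0
  then show ?case by (simp add: z_admissible_def)
next
  case (Suc n)
  let ?p = "z (Suc n) - Const c"
  have p1: "pd (Suc n) ?p = z n" by (simp add: pd_diff pd_z_Suc_self)
  have p2: "pd (Suc n) (pd (Suc n) ?p) = 0" unfolding p1 by (simp add: pd_z_eq_0)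
  have p0: "?p \<noteq> 0" using p1 by (auto simp: pd_0)
  \<comment> \<open>No nonzero multiple of a polynomial linear in a variable is free of that
    variable; this is the divisibility lemma with modulus 0.\<close>
  have free: "r = 0" if "?p dvd r" "pd (Suc n) r = 0" for r
  proof -
    from that(1) obtain q where q: "r = ?p * q" by blast
    have "0 dvd r"
      by (rule dvd_of_dvd_linear_mult_diff(2)[of 0 ?p q r "Suc n"])
         (use q that(2) p2 in \<open>simp_all add: p1 pd_0\<close>)
    then show ?thesis by simp
  qed
  have cancel: "?p dvd f" if "?p dvd z n * f" for f
  proof (cases n)
    case 0
    then show ?thesis using that by simp
  next
    case (Suc m)
    have "prime_elem (z n - Const (0 :: 'k))"
      by (rule Suc.IH) (use Suc in \<open>simp add: z_admissible_def\<close>)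
    then have pr: "prime_elem (z n :: 'k mpol)" by simp
    from that obtain q where q: "z n * f = ?p * q" by blast
    \<comment> \<open>Modulo z_n the polynomial is -(z_m + c). This is free of x_n, so a multiple of
      z_n, which is linear in x_n, only if it is 0.\<close>
    have "\<not> z n dvd ?p"
    proof
      assume "z n dvd ?p"
      then have d: "z n dvd z m + Const c"
        using Suc by (simp add: diff_diff_eq dvd_diff_right_iff)
      then obtain g where g: "z m + Const c = z n * g" by blast
      have pg: "pd n (z n * g) = 0" unfolding g[symmetric] using Suc by (simp add: pd_add pd_z_eq_0)
      have "0 dvd z m + Const c"
        by (rule dvd_of_dvd_linear_mult_diff(2)[of 0 "z n" g "z m + Const c" n])
           (use Suc pg in \<open>simp_all add: g pd_0 pd_z_eq_0 pd_z_Suc_self del: z.simps\<close>)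
      then have zm: "z m + Const c = 0" by simp
      \<comment> \<open>For \<open>m = 0\<close> the sum is 1 + c, which vanishes for c = -1, the
        exceptional z_2 + 1; admissibility at the even index 2 forces c = 0.\<close>
      show False
      proof (cases m)
        case 0
        with Suc Suc.prems have "c = 0" by (simp add: z_admissible_def)
        with 0 zm show False by simp
      next
        case (Suc l)
        have "pd m (z m + Const c) = z l" unfolding Suc by (simp add: pd_add pd_z_Suc_self del: z.simps)
        then show False using zm by (simp add: pd_0)
      qed
    qed
    moreover have "z n dvd ?p * q" unfolding q[symmetric] by simp
    ultimately have "z n dvd q" using pr by (simp add: prime_elem_dvd_mult_iff)
    then obtain h where "q = z n * h" by blast
    with q have "z n * f = z n * (?p * h)" by (simp add: algebra_simps)
    then show ?thesis by simp
  qed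
  have cancel_pow: "?p dvd f" if "?p dvd z n ^ k * f" for f k
    using that by (induction k) (auto simp: mult.assoc dest: cancel)
  have unit: "\<not> ?p dvd 1" using free[of 1] by (auto simp: pd_1)
  show ?case
  proof (rule prime_elemI[OF p0 unit])
    fix f g assume fg: "?p dvd f * g"
    obtain k q r where r: "z n ^ k * f = ?p * q + r" "pd (Suc n) r = 0"
      using z_pred_division[of f UNIV n c] by auto
    obtain l q' r' where r': "z n ^ l * g = ?p * q' + r'" "pd (Suc n) r' = 0"
      using z_pred_division[of g UNIV n c] by auto
    have "r * r' = z n ^ (k + l) * (f * g) - ?p * (q * (z n ^ l * g) + r * q')"
    proof -
      have "z n ^ (k + l) * (f * g) = (z n ^ k * f) * (z n ^ l * g)"
        by (simp add: power_add algebra_simps)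
      also have "\<dots> = ?p * (q * (z n ^ l * g) + r * q') + r * r'"
        unfolding r(1) r'(1) by (simp add: algebra_simps)
      finally show ?thesis by simp
    qed
    then have "?p dvd r * r'" using fg by simp
    moreover have "pd (Suc n) (r * r') = 0" using r r' by (simp add: pd_mult)
    ultimately have "r = 0 \<or> r' = 0" using free by fastforce
    then show "?p dvd f \<or> ?p dvd g"
    proof
      assume "r = 0"
      then show ?thesis using r(1) cancel_pow[of k f] by simp
    next
      assume "r' = 0"
      then show ?thesis using r'(1) cancel_pow[of l g] by simp
    qed
  qed
qed

section \<open>Eigenvectors and Laurent monomials\<close>

text \<open>Elementwise form of \<open>subring A (ring_on UNIV)\<close>, see
  \<open>closed_ring_iff_subring\<close>; it keeps the arithmetic in the type class.\<close>

definition closed_ring :: "'r::comm_ring_1 set \<Rightarrow> bool" where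
  "closed_ring A \<longleftrightarrow> 1 \<in> A \<and> (\<forall>a\<in>A. - a \<in> A) \<and> (\<forall>a\<in>A. \<forall>b\<in>A. a + b \<in> A \<and> a * b \<in> A)"

lemma closed_ringD:
  assumes "closed_ring A"
  shows "0 \<in> A" "1 \<in> A" "a \<in> A \<Longrightarrow> - a \<in> A"
    "a \<in> A \<Longrightarrow> b \<in> A \<Longrightarrow> a + b \<in> A" "a \<in> A \<Longrightarrow> b \<in> A \<Longrightarrow> a * b \<in> A"
    "a \<in> A \<Longrightarrow> b \<in> A \<Longrightarrow> a - b \<in> A"
proof -
  show *: "1 \<in> A" "\<And>a. a \<in> A \<Longrightarrow> - a \<in> A" "\<And>a b. a \<in> A \<Longrightarrow> b \<in> A \<Longrightarrow> a + b \<in> A"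
      "\<And>a b. a \<in> A \<Longrightarrow> b \<in> A \<Longrightarrow> a * b \<in> A"
    using assms unfolding closed_ring_def by blast+
  show "0 \<in> A" using *(3)[OF *(1) *(2)[OF *(1)]] by simp
  show "a - b \<in> A" if "a \<in> A" "b \<in> A" for a b
    using *(3)[OF that(1) *(2)[OF that(2)]] by simp
qed

lemma closed_ring_power: "closed_ring A \<Longrightarrow> a \<in> A \<Longrightarrow> a ^ k \<in> A"
  by (induction k) (auto intro: closed_ringD)

lemma closed_ring_sum: "closed_ring A \<Longrightarrow> (\<And>i. i \<in> I \<Longrightarrow> f i \<in> A) \<Longrightarrow> sum f I \<in> A"
  by (induction I rule: infinite_finite_induct) (auto intro: closed_ringD)

lemma closed_ring_prod: "closed_ring A \<Longrightarrow> (\<And>i. i \<in> I \<Longrightarrow> f i \<in> A) \<Longrightarrow> prod f I \<in> A"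
  by (induction I rule: infinite_finite_induct) (auto intro: closed_ringD)

lemma closed_ring_powi:
  fixes a :: "'f::field"
  assumes "closed_ring A" "a \<in> A" "inverse a \<in> A"
  shows "a powi k \<in> A"
  using assms by (cases "k \<ge> 0") (auto simp: power_int_def intro!: closed_ring_power)

lemma closed_ring_Fpoly: "closed_ring (Fpoly n)"
  unfolding closed_ring_def by auto

text \<open>The \<open>C\<close>-linear combinations of elements of \<open>M\<close>. The inductive
  form makes closure under products a short induction; finite sums are extracted only where terms
  have to be counted.\<close>

inductive_set span_over :: "'r::comm_ring_1 set \<Rightarrow> 'r set \<Rightarrow> 'r set" for C M where
  zero: "0 \<in> span_over C M"
| add: "c \<in> C \<Longrightarrow> m \<in> M \<Longrightarrow> f \<in> span_over C M \<Longrightarrow> c * m + f \<in> span_over C M"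

lemma span_over_plus: "f \<in> span_over C M \<Longrightarrow> g \<in> span_over C M \<Longrightarrow> f + g \<in> span_over C M"
  by (induction rule: span_over.induct) (auto intro: span_over.add simp: add.assoc)

lemma span_over_term: "c \<in> C \<Longrightarrow> m \<in> M \<Longrightarrow> c * m \<in> span_over C M"
  using span_over.add[OF _ _ span_over.zero] by fastforce

lemma closed_ring_span_over:
  assumes C: "closed_ring C" and M: "1 \<in> M" "\<And>a b. a \<in> M \<Longrightarrow> b \<in> M \<Longrightarrow> a * b \<in> M"
  shows "closed_ring (span_over C M)"
proof -
  have uminus: "- f \<in> span_over C M" if "f \<in> span_over C M" for f
    using that
  proof induction
    case (add c m f)
    then show ?case
      using span_over.add[of "- c" C m M "- f"] closed_ringD[OF C] by simp
  qed (simp add: span_over.zero)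
  have scal: "c * m * g \<in> span_over C M" if "c \<in> C" "m \<in> M" "g \<in> span_over C M" for c m g
    using that(3)
  proof induction
    case (add d l g)
    have "c * m * (d * l + g) = (c * d) * (m * l) + c * m * g" by (simp add: algebra_simps)
    then show ?case
      using add that M(2) closed_ringD[OF C] by (auto intro: span_over.add)
  qed (simp add: span_over.zero)
  have "f * g \<in> span_over C M" if "f \<in> span_over C M" "g \<in> span_over C M" for f g
    using that(1)
  proof induction
    case (add c m f)
    then show ?case using scal[OF _ _ that(2)] by (simp add: distrib_right span_over_plus)
  qed (simp add: span_over.zero)
  moreover have "1 \<in> span_over C M"
    using span_over_term[of 1 C 1 M] closed_ringD[OF C] M by simp
  ultimately show ?thesis
    unfolding closed_ring_def using uminus span_over_plus by blast
qed

lemma span_over_finite_sum: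
  assumes "closed_ring C" "f \<in> span_over C (e ` E)"
  shows "\<exists>S c. finite S \<and> S \<subseteq> E \<and> (\<forall>a. c a \<in> C) \<and> f = (\<Sum>a\<in>S. c a * e a)"
  using assms(2)
proof induction
  case zero
  show ?case by (rule exI[of _ "{}"], rule exI[of _ "\<lambda>_. 0"]) (use closed_ringD[OF assms(1)] in auto)
next
  case (add d m f)
  then obtain S c where S: "finite S" "S \<subseteq> E" "\<forall>a. c a \<in> C" "f = (\<Sum>a\<in>S. c a * e a)" by blast
  from add obtain b where b: "b \<in> E" "m = e b" by blast
  \<comment> \<open>The new term is merged into the coefficient at \<open>b\<close>. If
    \<open>b\<close> is not yet in \<open>S\<close>, the value \<open>c b\<close> is arbitrary and
    has to be replaced by 0.\<close>
  define c' where "c' = (\<lambda>a. if a = b then d + (if b \<in> S then c b else 0) else c a)"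
  have "(\<Sum>a\<in>insert b S. c' a * e a) = c' b * e b + (\<Sum>a\<in>S - {b}. c' a * e a)"
    by (rule sum.insert_remove) (rule S(1))
  also have "(\<Sum>a\<in>S - {b}. c' a * e a) = (\<Sum>a\<in>S - {b}. c a * e a)"
    by (rule sum.cong) (auto simp: c'_def)
  also have "c' b * e b + \<dots> = d * m + f"
    using sum.remove[OF S(1), of b "\<lambda>a. c a * e a"] S b by (auto simp: c'_def algebra_simps)
  finally have "d * m + f = (\<Sum>a\<in>insert b S. c' a * e a)" ..
  moreover have "\<forall>a. c' a \<in> C"
    using S add closed_ringD[OF assms(1)] by (auto simp: c'_def)
  ultimately show ?case using S b by (intro exI[of _ "insert b S"] exI[of _ c']) auto
qed

text \<open>If \<open>S\<close> has two elements, some \<open>T\<^sub>j - w\<^sub>j(a)\<close> removes the term at one of them and keeps the other,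
  so the number of terms can be lowered to one; that term is a scalar times a unit.\<close>

lemma eigenvector_reduction:
  fixes e :: "'a \<Rightarrow> 'f::field"
  assumes C: "closed_ring C"
    and I_add: "\<And>f g. f \<in> I \<Longrightarrow> g \<in> I \<Longrightarrow> f + g \<in> I"
    and I_mult: "\<And>c f. c \<in> C \<Longrightarrow> f \<in> I \<Longrightarrow> c * f \<in> I"
    and I_div: "\<And>a f. a \<in> E \<Longrightarrow> f \<in> I \<Longrightarrow> f / e a \<in> I"
    and I_T: "\<And>j f. j \<in> J \<Longrightarrow> f \<in> I \<Longrightarrow> T j f \<in> I"
    and e: "\<And>a. a \<in> E \<Longrightarrow> e a \<noteq> 0"
    and T_add: "\<And>j f g. T j (f + g) = T j f + T j g"
    and T_e: "\<And>j c a. j \<in> J \<Longrightarrow> c \<in> C \<Longrightarrow> a \<in> E \<Longrightarrow> T j (c * e a) = c * w j a * e a"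
    and w: "\<And>j a. w j a \<in> C"
    and sep: "\<And>a b. a \<in> E \<Longrightarrow> b \<in> E \<Longrightarrow> a \<noteq> b \<Longrightarrow> \<exists>j\<in>J. w j a \<noteq> w j b"
    and S: "finite S" "S \<subseteq> E" "S \<noteq> {}" "\<And>a. a \<in> S \<Longrightarrow> c a \<in> C \<and> c a \<noteq> 0"
    and mem: "(\<Sum>a\<in>S. c a * e a) \<in> I"
  shows "\<exists>d\<in>C. d \<noteq> 0 \<and> d \<in> I"
  using S mem
proof (induction "card S" arbitrary: S c rule: less_induct)
  case less
  have T_sum: "T j (\<Sum>a\<in>S. c a * e a) = (\<Sum>a\<in>S. c a * w j a * e a)" if "j \<in> J" for j
  proof -
    have T0: "T j 0 = 0" using T_add[of j 0 0] by (simp only: add_0_right add_cancel_right_right)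
    have "T j (\<Sum>a\<in>S'. c a * e a) = (\<Sum>a\<in>S'. c a * w j a * e a)" if "S' \<subseteq> S" "finite S'" for S'
      using that(2,1)
    proof (induction S' rule: finite_induct)
      case (insert a S')
      then show ?case using T_add T_e[OF \<open>j \<in> J\<close>, of "c a" a] less.prems by auto
    qed (simp add: T0)
    then show ?thesis using less.prems by blast
  qed
  from less.prems obtain a where a: "a \<in> S" by blast
  show ?case
  proof (cases "S = {a}")
    case True
    then have "c a * e a / e a \<in> I"
      using less.prems by (intro I_div) auto
    moreover have "e a \<noteq> 0" using a less.prems(2) e by blast
    ultimately have "c a \<in> I" by simp
    then show ?thesis using less.prems(4)[OF a] by blast
  next
    case False
    then obtain b where b: "b \<in> S" "b \<noteq> a" using a by blast
    then obtain j where j: "j \<in> J" "w j a \<noteq> w j b" using sep a less.prems by (metis subsetD)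
    \<comment> \<open>The support after applying T_j - w_j(a): it loses \<open>a\<close>, and it
      keeps \<open>b\<close> because the two weights differ.\<close>
    define S' where "S' = {x \<in> S. w j x \<noteq> w j a}"
    define c' where "c' x = c x * (w j x - w j a)" for x
    have "T j (\<Sum>x\<in>S. c x * e x) + (- w j a) * (\<Sum>x\<in>S. c x * e x) \<in> I"
      using less.prems(5) w j closed_ringD[OF C] by (intro I_add I_T I_mult) auto
    also have "T j (\<Sum>x\<in>S. c x * e x) + (- w j a) * (\<Sum>x\<in>S. c x * e x) = (\<Sum>x\<in>S. c' x * e x)"
      unfolding T_sum[OF j(1)] by (simp add: sum_distrib_left c'_def algebra_simps sum_negf sum_subtractf)
    also have "\<dots> = (\<Sum>x\<in>S'. c' x * e x)"
      by (rule sum.mono_neutral_right) (use less.prems in \<open>auto simp: S'_def c'_def\<close>)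
    finally have mem': "(\<Sum>x\<in>S'. c' x * e x) \<in> I" .
    have "S' \<subset> S" using a by (auto simp: S'_def)
    then have "card S' < card S" using less.prems(1) by (rule psubset_card_mono[rotated])
    then show ?thesis
    proof (rule less.hyps[OF _ _ _ _ _ mem'])
      show "finite S'" "S' \<subseteq> E" "S' \<noteq> {}" using less.prems b j by (auto simp: S'_def)
      show "c' x \<in> C \<and> c' x \<noteq> 0" if "x \<in> S'" for x
        using that less.prems closed_ringD[OF C] w by (auto simp: S'_def c'_def)
    qed
  qed
qed

section \<open>Polynomials, constants and integers in the field of fractions\<close>

lemma of_pol_simps:
  "of_pol 0 = 0" "of_pol 1 = 1" "of_pol (p + q) = of_pol p + of_pol q"
  "of_pol (p - q) = of_pol p - of_pol q" "of_pol (- p) = - of_pol p" "of_pol (p * q) = of_pol p * of_pol q"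
  by (simp_all add: fract_collapse)

lemma of_pol_eq_iff: "of_pol p = of_pol q \<longleftrightarrow> p = q"
  by (simp add: eq_fract)

lemma of_pol_eq_0_iff: "of_pol p = 0 \<longleftrightarrow> p = 0"
  using of_pol_eq_iff[of p 0] by (simp add: fract_collapse)

lemma of_pol_power: "of_pol (p ^ k) = of_pol p ^ k"
  by (induction k) (simp_all only: power_0 power_Suc of_pol_simps)

lemma of_pol_prod: "of_pol (prod f A) = (\<Prod>a\<in>A. of_pol (f a))"
  by (induction A rule: infinite_finite_induct) (simp_all only: prod.infinite prod.empty prod.insert of_pol_simps not_False_eq_True)

lemma Fract_conv_of_pol: "Fract f s = of_pol f / of_pol s"
  by (cases "s = 0") (simp_all add: fract_collapse)

lemma of_int_conv_Const: "(of_int k :: 'k::field mpol fract) = of_pol (Const (of_int k))"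
proof -
  have n: "(of_nat k :: 'k mpol fract) = of_pol (Const (of_nat k))" for k
    by (induction k) (simp_all only: of_nat_0 of_nat_Suc Const_0 Const_1 Const_add of_pol_simps)
  show ?thesis
    by (cases k rule: int_cases2) (simp_all only: of_int_of_nat_eq n of_int_minus Const_uminus of_pol_simps)
qed

text \<open>Carries the separation of integer weights over to eigenvalues in the field of
  fractions.\<close>

lemma of_int_eq_iff_fract:
  "(of_int k :: 'k::field_char_0 mpol fract) = of_int l \<longleftrightarrow> k = l"
proof
  assume "(of_int k :: 'k mpol fract) = of_int l"
  then have "Const (of_int k :: 'k) - Const (of_int l) = 0"
    by (simp only: of_int_conv_Const of_pol_eq_iff) simp
  then have "Const (of_int k - of_int l :: 'k) = 0" by (simp only: Const_diff)
  then show "k = l" by (simp only: Const_eq_0_iff) simp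
qed simp

lemma closed_ring_base_field: "closed_ring (base_field :: 'k::field mpol fract set)"
proof -
  have "of_pol (Const c) \<in> base_field" for c :: 'k by (auto simp: base_field_def)
  then show ?thesis
    unfolding closed_ring_def base_field_def
    by (auto simp flip: of_pol_simps Const_add Const_mult Const_uminus Const_1)
qed

lemma of_int_in_base_field: "of_int k \<in> base_field"
  by (auto simp: base_field_def of_int_conv_Const)

section \<open>Laurent monomials in z_1, ..., z_m and their weights\<close>

lemma zf_nonzero [simp]: "zf i \<noteq> 0"
  by (simp add: zf_def of_pol_eq_0_iff)

lemma zf_0 [simp]: "zf 0 = 1"
  by (simp add: zf_def fract_collapse)

lemma L_fbracket_zf:
  assumes "i \<le> n" "j \<le> n"
  shows "L_fbracket n (zf i) (zf j :: 'k::field mpol fract) = of_int (z_weight i j) * zf i * zf j"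
proof -
  have *: "(of_int (z_weight i j) :: 'k mpol fract) = of_pol (of_int (z_weight i j))"
    by (auto simp: z_weight_def fract_collapse of_pol_simps(5) simp del: minus_fract)
  then show ?thesis
    unfolding * zf_def L_fbracket_of_pol L_bracket_z_z[OF assms] by (simp only: of_pol_simps)
qed

text \<open>Exponents are fixed to 0 outside \<open>{1..m}\<close> so that equal exponent vectors
  are equal functions, as the separation of weights requires.\<close>

definition z_exps :: "nat \<Rightarrow> (nat \<Rightarrow> int) set" where
  "z_exps m = {a. \<forall>i. i \<notin> {1..m} \<longrightarrow> a i = 0}"

definition z_mono :: "nat \<Rightarrow> (nat \<Rightarrow> int) \<Rightarrow> 'k::field mpol fract" where
  "z_mono m a = (\<Prod>i=1..m. zf i powi a i)"

lemma z_mono_nonzero [simp]: "z_mono m a \<noteq> 0"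
  by (simp add: z_mono_def)

lemma z_mono_add: "z_mono m a * z_mono m b = z_mono m (\<lambda>i. a i + b i)"
  by (simp add: z_mono_def power_int_add flip: prod.distrib)

text \<open>\<open>h\<close> is the logarithmic derivative of \<open>f\<close>; negative exponents
  follow from D (f * inverse f) = D 1 = 0. The rule is applied to brackets with z_j and to partial
  derivatives.\<close>

lemma derivation_powi:
  fixes D :: "'f::field \<Rightarrow> 'f"
  assumes L: "\<And>f g. D (f * g) = f * D g + D f * g" and h: "D f = h * f" and f: "f \<noteq> 0"
  shows "D (f powi k) = of_int k * h * f powi k"
proof -
  have D1: "D 1 = 0" using L[of 1 1] by (simp only: mult_1 mult_1_right add_cancel_right_right)
  have pow: "D (g ^ n) = of_nat n * h * g ^ n" if "D g = h * g" for g h n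
    by (induction n) (simp_all add: D1 L that algebra_simps)
  have "f * D (inverse f) + h = 0" using L[of f "inverse f"] f by (simp add: D1 h mult.assoc)
  then have "f * D (inverse f) = - h" by (simp add: eq_neg_iff_add_eq_0)
  then have i: "D (inverse f) = (- h) * inverse f"
    using f by (simp add: field_simps)
  show ?thesis
  proof (cases "k \<ge> 0")
    case True
    then show ?thesis using pow[OF h, of "nat k"] by (simp add: power_int_def)
  next
    case False
    then show ?thesis using pow[OF i, of "nat (- k)"] by (simp add: power_int_def)
  qed
qed

lemma derivation_prod:
  fixes D :: "'f::field \<Rightarrow> 'f"
  assumes L: "\<And>f g. D (f * g) = f * D g + D f * g" and h: "\<And>i. i \<in> A \<Longrightarrow> D (F i) = h i * F i"
    and "finite A"
  shows "D (prod F A) = sum h A * prod F A"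
  using assms(3) h
proof (induction A rule: finite_induct)
  case empty
  have "D 1 = 0" using L[of 1 1] by (simp only: mult_1 mult_1_right add_cancel_right_right)
  then show ?case by simp
qed (simp add: L algebra_simps)

definition z_mono_weight :: "nat \<Rightarrow> nat \<Rightarrow> (nat \<Rightarrow> int) \<Rightarrow> int" where
  "z_mono_weight m j a = (\<Sum>i=1..m. a i * z_weight i j)"

lemma L_fbracket_z_mono:
  assumes "m \<le> n" "j \<le> n"
  shows "L_fbracket n (z_mono m a) (zf j) = of_int (z_mono_weight m j a) * zf j * z_mono m a"
proof -
  let ?D = "\<lambda>f. L_fbracket n f (zf j)"
  have "?D (z_mono m a) = (\<Sum>i=1..m. of_int (a i) * (of_int (z_weight i j) * zf j)) * z_mono m a"
    unfolding z_mono_def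
  proof (rule derivation_prod)
    show "?D (f * g) = f * ?D g + ?D f * g" for f g by (rule L_fbracket_Leibniz)
    show "?D (zf i powi a i) = of_int (a i) * (of_int (z_weight i j) * zf j) * zf i powi a i" if "i \<in> {1..m}" for i
      by (rule derivation_powi) (use that assms in \<open>auto simp: L_fbracket_Leibniz L_fbracket_zf\<close>)
  qed simp
  also have "(\<Sum>i=1..m. of_int (a i) * (of_int (z_weight i j) * zf j)) = of_int (z_mono_weight m j a) * zf j"
    by (simp add: z_mono_weight_def sum_distrib_right mult.assoc)
  finally show ?thesis .
qed

text \<open>For even \<open>m\<close> the exponents are recovered from the weights:
  \<open>a\<^sub>i = w\<^sub>i\<^sub>+\<^sub>1 - w\<^sub>i\<^sub>-\<^sub>1\<close>, where \<open>w\<^sub>0 = w\<^sub>m\<^sub>+\<^sub>1 = 0\<close>.\<close>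

lemma z_mono_weight_separates:
  assumes "even m" "a \<in> z_exps m" "b \<in> z_exps m" "a \<noteq> b"
  shows "\<exists>j\<in>{1..m}. z_mono_weight m j a \<noteq> z_mono_weight m j b"
proof (rule ccontr)
  assume "\<not> ?thesis"
  then have eq: "z_mono_weight m j a = z_mono_weight m j b" if "j \<in> {1..m}" for j using that by blast
  have "z_mono_weight m 0 c = 0" for c by (simp add: z_mono_weight_def z_weight_def)
  \<comment> \<open>Evenness of \<open>m\<close> enters here: \<open>Suc m\<close> is odd, and an
    odd index has weight 0 against every smaller one.\<close>
  moreover have "z_mono_weight m (Suc m) c = 0" for c
    using assms(1) by (auto simp: z_mono_weight_def z_weight_def intro!: sum.neutral)
  ultimately have eq': "z_mono_weight m j a = z_mono_weight m j b" if "j \<le> Suc m" for j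
    using eq[of j] that by (cases "j = 0"; cases "j = Suc m") auto
  have rec: "c i = z_mono_weight m (Suc i) c - z_mono_weight m (i - 1) c" if i: "i \<in> {1..m}" for c i
  proof -
    have "z_mono_weight m (Suc i) c - z_mono_weight m (i - 1) c = (\<Sum>k=1..m. c k * (z_weight k (Suc i) - z_weight k (i - 1)))"
      by (simp add: z_mono_weight_def algebra_simps flip: sum_subtractf)
    \<comment> \<open>The indices i + 1 and i - 1 have the same parity, so their weights agree at
      every k other than i. At k = i the difference is 1 - 0 for odd i and 0 - (-1) for even
      i.\<close>
    also have "\<dots> = (\<Sum>k=1..m. if k = i then c i else 0)"
    proof (rule sum.cong[OF refl])
      fix k assume "k \<in> {1..m}"
      consider "k < i - 1" | "k = i - 1" | "k = i" | "k = Suc i" | "k > Suc i" by linarith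
      then show "c k * (z_weight k (Suc i) - z_weight k (i - 1)) = (if k = i then c i else 0)"
        using i by cases (auto simp: z_weight_def)
    qed
    also have "\<dots> = c i" using i by simp
    finally show ?thesis ..
  qed
  have "a i = b i" for i
  proof (cases "i \<in> {1..m}")
    case True
    then show ?thesis using rec[of i a] rec[of i b] eq'[of "Suc i"] eq'[of "i - 1"] by auto
  qed (use assms in \<open>auto simp: z_exps_def\<close>)
  then show False using assms(4) by blast
qed

text \<open>Common core of simplicity and classification. \<open>I\<close> is merely a set closed
  under the operations of the torus, so that it can be an ideal of the localization as well as a
  localized prime of F_n. The scalars \<open>C\<close> are K, or K[z_n] when z_n is central and not
  inverted.\<close>

lemma torus_reduction:
  fixes C I :: "'k::field_char_0 mpol fract set"
  assumes "even m" "m \<le> n" and C: "closed_ring C" "base_field \<subseteq> C"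
    and C_central: "\<And>c j. c \<in> C \<Longrightarrow> j \<in> {1..m} \<Longrightarrow> L_fbracket n c (zf j) = 0"
    and I_add: "\<And>f g. f \<in> I \<Longrightarrow> g \<in> I \<Longrightarrow> f + g \<in> I"
    and I_mult: "\<And>c f. c \<in> C \<Longrightarrow> f \<in> I \<Longrightarrow> c * f \<in> I"
    and I_zf: "\<And>i f. i \<in> {1..m} \<Longrightarrow> f \<in> I \<Longrightarrow> zf i * f \<in> I"
    and I_zf_inv: "\<And>i f. i \<in> {1..m} \<Longrightarrow> f \<in> I \<Longrightarrow> inverse (zf i) * f \<in> I"
    and I_br: "\<And>i f. i \<in> {1..m} \<Longrightarrow> f \<in> I \<Longrightarrow> L_fbracket n f (zf i) \<in> I"
    and f: "f \<in> span_over C (z_mono m ` z_exps m)" "f \<noteq> 0" "f \<in> I"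
  shows "\<exists>d\<in>C. d \<noteq> 0 \<and> d \<in> I"
proof -
  obtain S c where S: "finite S" "S \<subseteq> z_exps m" "\<forall>a. c a \<in> C" "f = (\<Sum>a\<in>S. c a * z_mono m a)"
    using span_over_finite_sum[OF C(1) f(1)] by blast
  define S' where "S' = {a \<in> S. c a \<noteq> 0}"
  have fS': "f = (\<Sum>a\<in>S'. c a * z_mono m a)"
    unfolding S(4) by (rule sum.mono_neutral_right) (use S in \<open>auto simp: S'_def\<close>)
  \<comment> \<open>The multipliers of \<open>I\<close> form a monoid; once it contains the z_i and
    their inverses, \<open>I\<close> is closed under division by monomials.\<close>
  define I' where "I' = {g. \<forall>f\<in>I. g * f \<in> I}"
  have I'_prod: "prod F A \<in> I'" if "\<And>i. i \<in> A \<Longrightarrow> F i \<in> I'" "finite A" for F and A :: "nat set"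
    using that(2,1) by (induction A rule: finite_induct) (auto simp: I'_def mult.assoc)
  have I'_pow: "g ^ k \<in> I'" if "g \<in> I'" for g k
    using that by (induction k) (auto simp: I'_def mult.assoc)
  have I'_zf: "zf i powi k \<in> I'" if "i \<in> {1..m}" for i k
  proof -
    have "zf i \<in> I'" "inverse (zf i) \<in> I'" using that I_zf I_zf_inv by (auto simp: I'_def)
    then show ?thesis unfolding power_int_def using I'_pow by simp
  qed
  have inv: "f / z_mono m a \<in> I" if "f \<in> I" for f a
  proof -
    have "inverse (z_mono m a) = (\<Prod>i=1..m. zf i powi (- a i))"
      by (simp add: z_mono_def power_int_minus flip: prod_inversef)
    also have "\<dots> \<in> I'" by (intro I'_prod I'_zf) auto
    finally show ?thesis using that by (auto simp: I'_def divide_inverse mult.commute)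
  qed
  show ?thesis
  \<comment> \<open>Dividing the bracket with z_j by z_j makes the eigenvalues integers.\<close>
  proof (rule eigenvector_reduction[where E = "z_exps m" and e = "z_mono m" and C = C and I = I
        and J = "{1..m}" and T = "\<lambda>j f. inverse (zf j) * L_fbracket n f (zf j)"
        and w = "\<lambda>j a. of_int (z_mono_weight m j a)" and S = S' and c = c])
    show "inverse (zf j) * L_fbracket n (c * z_mono m a) (zf j) = c * of_int (z_mono_weight m j a) * z_mono m a"
      if "j \<in> {1..m}" "c \<in> C" for j c a
      using that assms(2) by (simp add: L_fbracket_Leibniz C_central L_fbracket_z_mono field_simps)
    show "\<exists>j\<in>{1..m}. (of_int (z_mono_weight m j a) :: 'k mpol fract) \<noteq> of_int (z_mono_weight m j b)"
      if "a \<in> z_exps m" "b \<in> z_exps m" "a \<noteq> b" for a b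
      using z_mono_weight_separates[OF assms(1) that] by (simp add: of_int_eq_iff_fract)
    show "S' \<noteq> {}" using f(2) fS' by auto
    show "(\<Sum>a\<in>S'. c a * z_mono m a) \<in> I" using f(3) fS' by simp
    show "of_int (z_mono_weight m j a) \<in> C" for j a
      using C(2) of_int_in_base_field by blast
  qed (use S C I_add I_mult I_zf_inv I_br inv in \<open>auto simp: S'_def L_fbracket_add distrib_left\<close>)
qed

text \<open>From x_i = (z_i + z_(i-2)) / z_(i-1), recovering x_1, ..., x_n takes the inverses of
  z_1, ..., z_(n-1) only.\<close>

lemma of_pol_mem_ring:
  fixes p :: "'k::field mpol"
  assumes S: "closed_ring S" "base_field \<subseteq> S"
    and zf: "\<And>i. i \<in> {1..n} \<Longrightarrow> zf i \<in> S" and inv: "\<And>i. i \<in> {1..<n} \<Longrightarrow> inverse (zf i) \<in> S"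
    and p: "p \<in> Fpoly n"
  shows "of_pol p \<in> S"
  using p
proof (induction rule: Fpoly_induct)
  case (Const c)
  then show ?case using S(2) by (auto simp: base_field_def)
next
  case (xvar i)
  show ?case
  proof (cases "i = 1")
    case True
    then show ?thesis using zf[of 1] xvar by (simp add: zf_def)
  next
    case False
    then obtain k where k: "i = Suc (Suc k)" using xvar by (metis One_nat_def atLeastAtMost_iff not0_implies_Suc not_one_le_zero)
    have "(zf i :: 'k mpol fract) = zf (Suc k) * of_pol (xvar i) - zf k"
      unfolding zf_def k z.simps of_pol_simps ..
    then have "of_pol (xvar i :: 'k mpol) = inverse (zf (Suc k)) * (zf i + zf k)"
      by (simp add: field_simps del: mult_fract add_fract diff_fract)
    moreover have "zf k \<in> S" using zf[of k] xvar k closed_ringD[OF S(1)] by (cases "k = 0") auto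
    ultimately show ?thesis
      using zf[of i] inv[of "Suc k"] xvar k closed_ringD[OF S(1)] by auto
  qed
next
  case (add p q)
  then show ?case unfolding of_pol_simps by (rule closed_ringD[OF S(1)])
next
  case (mult p q)
  then show ?case unfolding of_pol_simps by (rule closed_ringD[OF S(1)])
qed

lemma z_mono_zf:
  assumes "i \<in> {1..m}"
  shows "(zf i :: 'k::field mpol fract) powi k \<in> z_mono m ` z_exps m"
proof (rule image_eqI)
  have "(z_mono m (\<lambda>j. if j = i then k else 0) :: 'k mpol fract) = (\<Prod>j=1..m. if j = i then zf i powi k else 1)"
    unfolding z_mono_def by (rule prod.cong) auto
  then show "(zf i :: 'k mpol fract) powi k = z_mono m (\<lambda>j. if j = i then k else 0)" using assms by simp
qed (use assms in \<open>auto simp: z_exps_def\<close>)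

lemma closed_ring_torus:
  assumes "closed_ring C"
  shows "closed_ring (span_over C (z_mono m ` z_exps m))"
proof (rule closed_ring_span_over[OF assms])
  show "1 \<in> z_mono m ` z_exps m"
    by (rule image_eqI[of _ _ "\<lambda>_. 0"]) (auto simp: z_mono_def z_exps_def)
  show "a * b \<in> z_mono m ` z_exps m" if "a \<in> z_mono m ` z_exps m" "b \<in> z_mono m ` z_exps m" for a b
    using that by (auto simp: z_mono_add z_exps_def intro!: imageI)
qed

text \<open>Both \<open>n = m\<close> and \<open>n = Suc m\<close> occur. In the latter case z_n is
  one of the scalars, and it stays without an inverse.\<close>

lemma of_pol_mem_torus:
  assumes C: "closed_ring C" "base_field \<subseteq> C" and zf: "\<And>i. i \<in> {m<..n} \<Longrightarrow> zf i \<in> C"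
    and "n \<le> Suc m" "p \<in> Fpoly n"
  shows "of_pol p \<in> span_over C (z_mono m ` z_exps m)" (is "_ \<in> ?S")
proof (rule of_pol_mem_ring[OF _ _ _ _ assms(5)])
  show S: "closed_ring ?S" using C(1) by (rule closed_ring_torus)
  have one: "1 \<in> z_mono m ` z_exps m"
    by (rule image_eqI[of _ _ "\<lambda>_. 0"]) (auto simp: z_mono_def z_exps_def)
  have CS: "c \<in> ?S" if "c \<in> C" for c
    using span_over_term[OF that one] by simp
  then show "base_field \<subseteq> ?S" using C(2) by blast
  have powi: "zf i powi k \<in> ?S" if "i \<in> {1..m}" for i k
    using span_over_term[OF closed_ringD(2)[OF C(1)] z_mono_zf[OF that, of k]] by simp
  show "zf i \<in> ?S" if "i \<in> {1..n}" for i
    using powi[of i 1] zf[of i] CS that by (cases "i \<le> m") auto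
  show "inverse (zf i) \<in> ?S" if "i \<in> {1..<n}" for i
    using powi[of i "-1"] that assms(4) by (auto simp: power_int_minus)
qed

section \<open>Poisson prime ideals\<close>

lemma ring_on_simps [simp]:
  "carrier (ring_on A) = A" "x \<otimes>\<^bsub>ring_on A\<^esub> y = x * y" "x \<oplus>\<^bsub>ring_on A\<^esub> y = x + y"
  "\<one>\<^bsub>ring_on A\<^esub> = 1" "\<zero>\<^bsub>ring_on A\<^esub> = 0"
  by (simp_all add: ring_on_def ring_of_type_algebra_def)

lemma cring_ring_on:
  assumes "closed_ring A" shows "cring (ring_on A)"
proof (rule cringI)
  show "abelian_group (ring_on A)"
    by (rule abelian_groupI)
       (use closed_ringD[OF assms] in \<open>auto simp: algebra_simps intro: bexI[of _ "- x" for x]\<close>)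
  show "Group.comm_monoid (ring_on A)"
    by (rule comm_monoidI) (use closed_ringD[OF assms] in \<open>auto simp: algebra_simps\<close>)
qed (simp add: algebra_simps)

lemma ideal_ring_on_iff:
  assumes A: "closed_ring A"
  shows "ideal I (ring_on A) \<longleftrightarrow>
    I \<subseteq> A \<and> 0 \<in> I \<and> (\<forall>a\<in>I. \<forall>b\<in>I. a + b \<in> I) \<and> (\<forall>a\<in>A. \<forall>b\<in>I. a * b \<in> I)" (is "_ \<longleftrightarrow> ?R")
proof
  assume "ideal I (ring_on A)"
  then interpret ideal I "ring_on A" .
  show ?R
    using a_subset I_l_closed additive_subgroup.zero_closed[OF is_additive_subgroup]
      additive_subgroup.a_closed[OF is_additive_subgroup] by auto
next
  assume R: ?R
  interpret cring "ring_on A" using A by (rule cring_ring_on)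
  have neg: "- a \<in> I" if "a \<in> I" for a
  proof -
    have "- 1 * a \<in> I" using R that closed_ringD[OF A] by blast
    then show ?thesis by simp
  qed
  show "ideal I (ring_on A)"
  proof (rule idealI)
    show "subgroup I (add_monoid (ring_on A))"
    proof (rule add.subgroupI)
      show "\<ominus>\<^bsub>ring_on A\<^esub> a \<in> I" if "a \<in> I" for a
      proof -
        have "\<ominus>\<^bsub>ring_on A\<^esub> a = - a"
          by (rule minus_equality) (use that R neg in auto)
        then show ?thesis using neg that by simp
      qed
    qed (use R in auto)
    show "a \<otimes>\<^bsub>ring_on A\<^esub> x \<in> I" if "a \<in> I" "x \<in> carrier (ring_on A)" for a x
      using R that by (metis mult.commute ring_on_simps(1,2))
  qed (use R ring_axioms in auto)
qed

lemma closed_ring_iff_subring: "closed_ring A \<longleftrightarrow> subring A (ring_on UNIV)"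
proof -
  interpret cring "ring_on (UNIV :: 'a set)"
    by (rule cring_ring_on) (simp add: closed_ring_def)
  have neg: "\<ominus>\<^bsub>ring_on UNIV\<^esub> a = - a" for a :: 'a
    by (rule minus_equality) auto
  show ?thesis
  proof
    assume "closed_ring A"
    from closed_ringD[OF this] show "subring A (ring_on UNIV)"
      by (intro subringI) (auto simp: neg)
  next
    assume "subring A (ring_on UNIV)"
    from subringE[OF this] show "closed_ring A" by (auto simp: closed_ring_def neg)
  qed
qed

lemma subring_ring_onI:
  assumes "closed_ring A" "closed_ring B" "B \<subseteq> A"
  shows "subring B (ring_on A)"
proof -
  interpret cring "ring_on A" using assms(1) by (rule cring_ring_on)
  have "\<ominus>\<^bsub>ring_on A\<^esub> a = - a" if "a \<in> B" for a
    by (rule minus_equality) (use that assms(3) closed_ringD[OF assms(2)] in auto)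
  then show ?thesis
    using closed_ringD[OF assms(2)] assms(3) by (intro subringI) auto
qed

definition is_poisson_prime :: "nat \<Rightarrow> 'k::field mpol set \<Rightarrow> bool" where
  "is_poisson_prime n P \<longleftrightarrow> P \<subseteq> Fpoly n \<and> 0 \<in> P \<and> (\<forall>a\<in>P. \<forall>b\<in>P. a + b \<in> P) \<and> (\<forall>a\<in>Fpoly n. \<forall>b\<in>P. a * b \<in> P) \<and>
     (\<forall>a\<in>P. \<forall>b\<in>Fpoly n. L_bracket n a b \<in> P) \<and> 1 \<notin> P \<and>
     (\<forall>a\<in>Fpoly n. \<forall>b\<in>Fpoly n. a * b \<in> P \<longrightarrow> a \<in> P \<or> b \<in> P)"

lemma poisson_prime_ideal_iff: "poisson_prime_ideal (L_bracket n) (Fpoly n) P \<longleftrightarrow> is_poisson_prime n P"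
proof
  assume "poisson_prime_ideal (L_bracket n) (Fpoly n) P"
  then have P: "primeideal P (ring_on (Fpoly n))" and br: "\<forall>a\<in>P. \<forall>b\<in>Fpoly n. L_bracket n a b \<in> P"
    by (auto simp: poisson_prime_ideal_def poisson_ideal_def)
  interpret primeideal P "ring_on (Fpoly n)" by (rule P)
  have id: "P \<subseteq> Fpoly n \<and> 0 \<in> P \<and> (\<forall>a\<in>P. \<forall>b\<in>P. a + b \<in> P) \<and> (\<forall>a\<in>Fpoly n. \<forall>b\<in>P. a * b \<in> P)"
    using ideal_axioms by (simp add: ideal_ring_on_iff closed_ring_Fpoly)
  moreover have "1 \<notin> P"
  proof
    assume "1 \<in> P"
    then have "a * 1 \<in> P" if "a \<in> Fpoly n" for a using id that by blast
    then show False using id I_notcarr by auto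
  qed
  moreover have "\<forall>a\<in>Fpoly n. \<forall>b\<in>Fpoly n. a * b \<in> P \<longrightarrow> a \<in> P \<or> b \<in> P"
    using I_prime by auto
  ultimately show "is_poisson_prime n P" using br by (simp add: is_poisson_prime_def)
next
  assume P: "is_poisson_prime n P"
  have id: "ideal P (ring_on (Fpoly n))"
    using P by (simp add: ideal_ring_on_iff closed_ring_Fpoly is_poisson_prime_def)
  moreover have "primeideal P (ring_on (Fpoly n))"
    using id cring_ring_on[OF closed_ring_Fpoly]
  proof (rule primeidealI)
    show "carrier (ring_on (Fpoly n)) \<noteq> P" using P by (auto simp: is_poisson_prime_def)
  qed (use P in \<open>auto simp: is_poisson_prime_def\<close>)
  ultimately show "poisson_prime_ideal (L_bracket n) (Fpoly n) P"
    using P by (simp add: poisson_prime_ideal_def poisson_ideal_def is_poisson_prime_def)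
qed

lemma is_poisson_primeD:
  assumes "is_poisson_prime n P"
  shows "P \<subseteq> Fpoly n" "a \<in> P \<Longrightarrow> a \<in> Fpoly n" "0 \<in> P" "a \<in> P \<Longrightarrow> b \<in> P \<Longrightarrow> a + b \<in> P"
    "a \<in> Fpoly n \<Longrightarrow> b \<in> P \<Longrightarrow> a * b \<in> P" "b \<in> P \<Longrightarrow> a \<in> Fpoly n \<Longrightarrow> b * a \<in> P"
    "a \<in> P \<Longrightarrow> b \<in> P \<Longrightarrow> a - b \<in> P" "a \<in> P \<Longrightarrow> - a \<in> P"
    "a \<in> P \<Longrightarrow> b \<in> Fpoly n \<Longrightarrow> L_bracket n a b \<in> P" "1 \<notin> P"
    "a \<in> Fpoly n \<Longrightarrow> b \<in> Fpoly n \<Longrightarrow> a * b \<in> P \<Longrightarrow> a \<in> P \<or> b \<in> P"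
proof -
  have P: "P \<subseteq> Fpoly n" "\<forall>a\<in>P. \<forall>b\<in>P. a + b \<in> P" "\<forall>a\<in>Fpoly n. \<forall>b\<in>P. a * b \<in> P"
    "\<forall>a\<in>P. \<forall>b\<in>Fpoly n. L_bracket n a b \<in> P"
    "\<forall>a\<in>Fpoly n. \<forall>b\<in>Fpoly n. a * b \<in> P \<longrightarrow> a \<in> P \<or> b \<in> P"
    using assms by (simp_all add: is_poisson_prime_def)
  show "P \<subseteq> Fpoly n" "a \<in> P \<Longrightarrow> a \<in> Fpoly n" using P(1) by auto
  show "0 \<in> P" "1 \<notin> P" using assms by (simp_all add: is_poisson_prime_def)
  show add: "a + b \<in> P" if "a \<in> P" "b \<in> P" for a b using P(2) that by simp
  show mult: "a * b \<in> P" if "a \<in> Fpoly n" "b \<in> P" for a b using P(3) that by simp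
  show "L_bracket n a b \<in> P" if "a \<in> P" "b \<in> Fpoly n" using P(4) that by simp
  show "a \<in> P \<or> b \<in> P" if "a \<in> Fpoly n" "b \<in> Fpoly n" "a * b \<in> P" using P(5) that by simp
  show neg: "- a \<in> P" if "a \<in> P" for a
    using mult[of "- 1" a] that by (simp add: Fpoly_uminus)
  show "a - b \<in> P" if "a \<in> P" "b \<in> P"
    using add[OF that(1) neg[OF that(2)]] by simp
  show "b * a \<in> P" if "b \<in> P" "a \<in> Fpoly n"
    using mult[OF that(2,1)] by (simp add: mult.commute)
qed

lemma poisson_prime_Const:
  assumes "is_poisson_prime n P" "Const c \<in> P" shows "c = 0"
proof (rule ccontr)
  assume "c \<noteq> 0"
  have "Const (inverse c) * Const c \<in> P" using assms by (intro is_poisson_primeD(5)) auto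
  with \<open>c \<noteq> 0\<close> is_poisson_primeD(10)[OF assms(1)] show False by (simp flip: Const_mult)
qed

lemma poisson_prime_power:
  assumes "is_poisson_prime n P" "a \<in> Fpoly n" "a ^ k \<in> P" shows "a \<in> P"
  using assms(3)
proof (induction k)
  case 0
  then show ?case using is_poisson_primeD(10)[OF assms(1)] by simp
next
  case (Suc k)
  then show ?case using is_poisson_primeD(11)[OF assms(1), of a "a ^ k"] assms(2) by auto
qed

lemma poisson_prime_prod:
  assumes "is_poisson_prime n P" "finite A" "\<And>i. i \<in> A \<Longrightarrow> f i \<in> Fpoly n" "prod f A \<in> P"
  shows "\<exists>i\<in>A. f i \<in> P"
  using assms(2-)
proof (induction A rule: finite_induct)
  case empty
  then show ?case using is_poisson_primeD(10)[OF assms(1)] by simp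
next
  case (insert i A)
  then have "f i \<in> P \<or> prod f A \<in> P"
    using is_poisson_primeD(11)[OF assms(1), of "f i" "prod f A"] by auto
  then show ?case using insert by auto
qed

section \<open>Poisson primes and products of the z_i\<close>

lemma z_monoid_one: "1 \<in> z_monoid n"
  unfolding z_monoid_def by (auto intro!: exI[of _ "\<lambda>_. 0"])

lemma z_monoid_mult: "s \<in> z_monoid n \<Longrightarrow> t \<in> z_monoid n \<Longrightarrow> s * t \<in> z_monoid n"
proof -
  assume "s \<in> z_monoid n" "t \<in> z_monoid n"
  then obtain d e where "s = (\<Prod>i=1..n. z i ^ d i)" "t = (\<Prod>i=1..n. z i ^ e i)"
    unfolding z_monoid_def by blast
  then have "s * t = (\<Prod>i=1..n. z i ^ (d i + e i))"
    by (simp add: power_add prod.distrib)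
  then show ?thesis unfolding z_monoid_def by (auto intro!: exI[of _ "\<lambda>i. d i + e i"])
qed

lemma z_monoid_z:
  assumes "i \<in> {1..n}" shows "(z i :: 'k::field mpol) \<in> z_monoid n"
proof -
  have "(\<Prod>j=1..n. z j ^ (if j = i then 1 else 0)) = (\<Prod>j=1..n. if j = i then z i else (1 :: 'k mpol))"
    by (rule prod.cong) auto
  also have "\<dots> = z i" using assms by simp
  finally show ?thesis unfolding z_monoid_def by (auto intro!: exI[of _ "\<lambda>j. if j = i then 1 else 0"])
qed

lemma z_monoid_Fpoly: "s \<in> z_monoid m \<Longrightarrow> m \<le> n \<Longrightarrow> s \<in> Fpoly n"
  unfolding z_monoid_def by (auto intro!: Fpoly_prod Fpoly_power)

lemma z_monoid_nonzero: "s \<in> z_monoid n \<Longrightarrow> s \<noteq> 0"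
  unfolding z_monoid_def by auto

lemma poisson_prime_z_monoid:
  assumes "is_poisson_prime n P" "s \<in> z_monoid m" "m \<le> n" "s \<in> P"
  shows "\<exists>i\<in>{1..m}. z i \<in> P"
proof -
  obtain e where "s = (\<Prod>i=1..m. z i ^ e i)" using assms(2) unfolding z_monoid_def by blast
  then have "\<exists>i\<in>{1..m}. z i ^ e i \<in> P"
    by (intro poisson_prime_prod[OF assms(1)]) (use assms(3,4) in \<open>auto intro!: Fpoly_power\<close>)
  then obtain i where i: "i \<in> {1..m}" "z i ^ e i \<in> P" by blast
  have "z i \<in> P"
    by (rule poisson_prime_power[OF assms(1) _ i(2)]) (use i(1) assms(3) in auto)
  then show ?thesis using i(1) by blast
qed

text \<open>\<open>{z\<^sub>i, x\<^sub>i\<^sub>+\<^sub>1}\<close> is \<open>z\<^sub>i\<^sub>+\<^sub>1\<close> or \<open>- z\<^sub>i\<^sub>-\<^sub>1\<close>, and two consecutive \<open>z\<close>'s generate all the previous ones.\<close>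

lemma poisson_prime_z_not_mem:
  assumes P: "is_poisson_prime n P" and i: "i < n"
  shows "z i \<notin> P"
proof -
  \<comment> \<open>The recursion z_i = z_(i+1) x_(i+2) - z_(i+2) descends from two consecutive
    members to z_0 = 1.\<close>
  have pair: "False" if "i < n" "z i \<in> P" "z (Suc i) \<in> P" for i
    using that
  proof (induction i)
    case 0
    then show ?case using is_poisson_primeD(10)[OF P] by simp
  next
    case (Suc i)
    have "z (Suc i) * xvar (Suc (Suc i)) - z (Suc (Suc i)) \<in> P"
      using Suc.prems by (intro is_poisson_primeD(7,6)[OF P] Fpoly_xvar) auto
    then have "z i \<in> P" by simp
    then show ?case using Suc by simp
  qed
  show ?thesis
  proof
    assume zi: "z i \<in> P"
    have br: "L_bracket n (z i) (xvar (Suc i)) \<in> P"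
      by (rule is_poisson_primeD(9)[OF P zi]) (use i in auto)
    show False
    proof (cases "odd i")
      case True
      then show False using br i zi pair[of i] by (simp add: L_bracket_z_xvar del: z.simps)
    next
      case False
      show False
      proof (cases i)
        case 0
        then show ?thesis using zi is_poisson_primeD(10)[OF P] by simp
      next
        case (Suc k)
        then have "- z k \<in> P" using br i False by (simp add: L_bracket_z_xvar del: z.simps)
        then have "z k \<in> P" using is_poisson_primeD(8)[OF P, of "- z k"] by simp
        then show ?thesis using pair[of k] zi Suc i by simp
      qed
    qed
  qed
qed

lemma poisson_prime_restrict:
  assumes P: "is_poisson_prime n P" and "m \<le> n"
  shows "is_poisson_prime m (P \<inter> Fpoly m)"
  unfolding is_poisson_prime_def
proof (intro conjI ballI)
  note sub = subsetD[OF Fpoly_mono[OF assms(2)]]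
  show "L_bracket m a b \<in> P \<inter> Fpoly m" if "a \<in> P \<inter> Fpoly m" "b \<in> Fpoly m" for a b
    using that is_poisson_primeD(9)[OF P, of a b] sub[of b] L_bracket_restrict[of a m b n] assms(2) by auto
  show "a * b \<in> P \<inter> Fpoly m" if "a \<in> Fpoly m" "b \<in> P \<inter> Fpoly m" for a b
    using that is_poisson_primeD(5)[OF P] sub by auto
  show "a * b \<in> P \<inter> Fpoly m \<longrightarrow> a \<in> P \<inter> Fpoly m \<or> b \<in> P \<inter> Fpoly m" if "a \<in> Fpoly m" "b \<in> Fpoly m" for a b
    using that is_poisson_primeD(11)[OF P] sub by blast
qed (use is_poisson_primeD[OF P] in auto)

text \<open>P is extended to the localization at z_1, ..., z_m, where \<open>torus_reduction\<close>
  yields a nonzero scalar. Clearing its denominator leads back to P, and primality removes the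
  denominator because P contains none of these z_i. Here \<open>m\<close> is the even one of
  \<open>n\<close> and \<open>n - 1\<close>.\<close>

lemma poisson_prime_contains_scalar:
  fixes P :: "'k::field_char_0 mpol set"
  assumes P: "is_poisson_prime n P" "P \<noteq> {0}" and m: "even m" "m \<le> n" "n \<le> Suc m"
    and no_z: "\<And>i. i \<in> {1..m} \<Longrightarrow> z i \<notin> P"
    and C: "closed_ring (of_pol ` C)" "base_field \<subseteq> of_pol ` C" "C \<subseteq> Fpoly n"
    and zC: "\<And>i. i \<in> {m<..n} \<Longrightarrow> z i \<in> C"
    and central: "\<And>c g. c \<in> C \<Longrightarrow> g \<in> Fpoly n \<Longrightarrow> L_bracket n c g = 0"
  shows "\<exists>d\<in>C. d \<noteq> 0 \<and> d \<in> P"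
proof -
  \<comment> \<open>The extension of P, described by cleared denominators inside the field of
    fractions.\<close>
  define I where "I = {f. \<exists>s\<in>z_monoid m. \<exists>p\<in>P. f * of_pol s = of_pol p}"
  have PI: "of_pol p \<in> I" if "p \<in> P" for p
  proof -
    have "of_pol p * of_pol 1 = of_pol p" by (simp only: of_pol_simps mult_1_right)
    then show ?thesis unfolding I_def using that z_monoid_one by blast
  qed
  have mult: "of_pol c * f \<in> I" if "c \<in> Fpoly n" "f \<in> I" for c f
  proof -
    from that obtain s p where s: "s \<in> z_monoid m" "p \<in> P" "f * of_pol s = of_pol p" by (auto simp: I_def)
    have "of_pol c * f * of_pol s = of_pol (c * p)"
      by (simp only: of_pol_simps flip: s(3)) (simp only: mult.assoc)
    then show ?thesis using s is_poisson_primeD(5)[OF P(1) that(1)] by (auto simp: I_def)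
  qed
  have "\<exists>d\<in>of_pol ` C. d \<noteq> 0 \<and> d \<in> I"
  proof -
    obtain p where p: "p \<in> P" "p \<noteq> 0" using P is_poisson_primeD(3)[OF P(1)] by blast
    show ?thesis
    proof (rule torus_reduction[where m = m and n = n and f = "of_pol p"])
      show "L_fbracket n c (zf j) = 0" if "c \<in> of_pol ` C" "j \<in> {1..m}" for c j
      proof -
        from that obtain d where d: "d \<in> C" "c = of_pol d" by blast
        have "L_bracket n d (z j) = 0" using d that m by (intro central) auto
        then show ?thesis unfolding d(2) zf_def L_fbracket_of_pol by (simp add: fract_collapse)
      qed
      show "f + g \<in> I" if "f \<in> I" "g \<in> I" for f g
      proof -
        from that obtain s p t q where s: "s \<in> z_monoid m" "p \<in> P" "f * of_pol s = of_pol p"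
          and t: "t \<in> z_monoid m" "q \<in> P" "g * of_pol t = of_pol q" by (auto simp: I_def)
        have "(f + g) * of_pol (s * t) = (f * of_pol s) * of_pol t + (g * of_pol t) * of_pol s"
          by (simp only: of_pol_simps) (simp only: algebra_simps)
        also have "\<dots> = of_pol (p * t + q * s)" by (simp only: of_pol_simps s t)
        finally show ?thesis
          using s t z_monoid_mult[of s m t] z_monoid_Fpoly[OF s(1) m(2)] z_monoid_Fpoly[OF t(1) m(2)] is_poisson_primeD(4,6)[OF P(1)]
          unfolding I_def by blast
      qed
      show "c * f \<in> I" if "c \<in> of_pol ` C" "f \<in> I" for c f
        using that mult C(3) by blast
      show "zf i * f \<in> I" if "i \<in> {1..m}" "f \<in> I" for i f
        unfolding zf_def using that m by (intro mult z_Fpoly_le) auto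
      show "inverse (zf i) * f \<in> I" if i: "i \<in> {1..m}" and f: "f \<in> I" for i f
      proof -
        from f obtain s p where s: "s \<in> z_monoid m" "p \<in> P" "f * of_pol s = of_pol p" by (auto simp: I_def)
        have "inverse (zf i) * f * of_pol (s * z i) = f * of_pol s * (inverse (zf i) * zf i)"
          unfolding zf_def by (simp only: of_pol_simps) (simp only: ac_simps)
        also have "\<dots> = of_pol p" by (subst left_inverse) (simp_all add: s)
        finally show ?thesis
          using s z_monoid_mult[OF s(1) z_monoid_z[OF i]] unfolding I_def by blast
      qed
      show "L_fbracket n f (zf i) \<in> I" if i: "i \<in> {1..m}" and f: "f \<in> I" for i f
      proof -
        from f obtain s p where s: "s \<in> z_monoid m" "p \<in> P" "f * of_pol s = of_pol p" by (auto simp: I_def)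
        have sF: "s \<in> Fpoly n" "z i \<in> Fpoly n" using z_monoid_Fpoly[OF s(1) m(2)] i m by auto
        have "L_fbracket n (f * of_pol s) (zf i) = of_pol (L_bracket n p (z i))"
          unfolding s(3) zf_def L_fbracket_of_pol ..
        then have "f * of_pol (L_bracket n s (z i)) + L_fbracket n f (zf i) * of_pol s = of_pol (L_bracket n p (z i))"
          unfolding L_fbracket_Leibniz zf_def L_fbracket_of_pol .
        \<comment> \<open>The bracket of the quotient f = p / s: one more factor s turns the
          remaining f into p, so {f, z_i} s^2 = {p, z_i} s - p {s, z_i}.\<close>
        then have "(f * of_pol (L_bracket n s (z i)) + L_fbracket n f (zf i) * of_pol s) * of_pol s = of_pol (L_bracket n p (z i)) * of_pol s"
          by (simp only:)
        then have "L_fbracket n f (zf i) * (of_pol s * of_pol s) =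
            of_pol (L_bracket n p (z i)) * of_pol s - (f * of_pol s) * of_pol (L_bracket n s (z i))"
          by (simp only: algebra_simps eq_diff_eq)
        also have "\<dots> = of_pol (L_bracket n p (z i) * s - p * L_bracket n s (z i))"
          unfolding s(3) by (simp only: of_pol_simps)
        finally have "L_fbracket n f (zf i) * of_pol (s * s) = of_pol (L_bracket n p (z i) * s - p * L_bracket n s (z i))"
          by (simp only: of_pol_simps)
        moreover have "L_bracket n p (z i) * s - p * L_bracket n s (z i) \<in> P"
          using sF s by (intro is_poisson_primeD(7,6,9)[OF P(1)] L_bracket_Fpoly) auto
        ultimately show ?thesis using z_monoid_mult[OF s(1) s(1)] unfolding I_def by blast
      qed
      show "of_pol p \<in> span_over (of_pol ` C) (z_mono m ` z_exps m)"
      proof (rule of_pol_mem_torus[OF C(1,2) _ m(3)])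
        show "zf i \<in> of_pol ` C" if "i \<in> {m<..n}" for i
          using zC[OF that] by (auto simp: zf_def)
      qed (use p is_poisson_primeD(1)[OF P(1)] in auto)
    qed (use m C p PI in \<open>auto simp: of_pol_eq_0_iff\<close>)
  qed
  then obtain d s p where d: "d \<in> C" "d \<noteq> 0" "s \<in> z_monoid m" "p \<in> P" "of_pol d * of_pol s = of_pol p"
    by (auto simp: I_def of_pol_eq_0_iff)
  from d(5) have "d * s = p" by (simp only: of_pol_eq_iff flip: of_pol_simps)
  then have "d \<in> P \<or> s \<in> P"
    using d z_monoid_Fpoly[OF d(3) m(2)] C(3) by (intro is_poisson_primeD(11)[OF P(1)]) auto
  moreover have "s \<notin> P" using poisson_prime_z_monoid[OF P(1) d(3) m(2)] no_z by blast
  ultimately show ?thesis using d by blast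
qed

text \<open>If P contained no z_i, the scalars K with \<open>m = n\<close> would put a nonzero
  constant into P. So some z_i lies in P, and z_n is the only one that can.\<close>

lemma poisson_prime_even_z_mem:
  fixes P :: "'k::field_char_0 mpol set"
  assumes "is_poisson_prime n P" "P \<noteq> {0}" "even n"
  shows "n > 0 \<and> z n \<in> P"
proof -
  have "\<exists>i\<in>{1..n}. z i \<in> P"
  proof (rule ccontr)
    assume *: "\<not> ?thesis"
    have b: "of_pol ` range Const = (base_field :: 'k mpol fract set)" by (auto simp: base_field_def)
    have "\<exists>d\<in>range Const. d \<noteq> 0 \<and> d \<in> P"
      by (rule poisson_prime_contains_scalar[OF assms(1,2,3)])
         (use * in \<open>auto simp: b closed_ring_base_field L_bracket_Const\<close>)
    then show False using poisson_prime_Const[OF assms(1)] by auto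
  qed
  then show ?thesis using poisson_prime_z_not_mem[OF assms(1)] by (metis atLeastAtMost_iff le_neq_implies_less less_le_trans zero_less_one)
qed

text \<open>Evaluation of K[t] at \<open>y\<close>; its range at \<open>z n\<close> is the ring of
  scalars K[z_n] for odd n.\<close>

definition poly_at :: "'k::field mpol \<Rightarrow> 'k poly \<Rightarrow> 'k mpol" where
  "poly_at y p = poly (map_poly Const p) y"

lemma poly_at_pCons [simp]: "poly_at y (pCons a p) = Const a + y * poly_at y p"
  by (simp add: poly_at_def map_poly_pCons)

lemma poly_at_0 [simp]: "poly_at y 0 = 0"
  by (simp add: poly_at_def)

lemma poly_at_add: "poly_at y (p + q) = poly_at y p + poly_at y q"
  by (induction p q rule: poly_induct2) (simp_all add: Const_add algebra_simps)

lemma poly_at_smult: "poly_at y (smult a p) = Const a * poly_at y p"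
  by (induction p) (simp_all add: Const_mult algebra_simps)

lemma poly_at_mult: "poly_at y (p * q) = poly_at y p * poly_at y q"
  by (induction p) (simp_all add: poly_at_add poly_at_smult algebra_simps)

lemma poly_at_Fpoly: "y \<in> Fpoly n \<Longrightarrow> poly_at y p \<in> Fpoly n"
  by (induction p) auto

text \<open>With m = n - 1 the scalars are the central ring K[z_n], so P contains a nonzero p(z_n).
  Over an algebraically closed field p splits, and primality selects a linear factor.\<close>

lemma poisson_prime_odd_z_mem:
  fixes P :: "'k::{alg_closed_field, field_char_0} mpol set"
  assumes P: "is_poisson_prime n P" "P \<noteq> {0}" and "odd n"
  shows "\<exists>c. z n - Const c \<in> P"
proof -
  let ?C = "range (poly_at (z n :: 'k mpol))"
  obtain m where m: "n = Suc m" "even m" using assms(3) by (cases n) auto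
  have const: "Const c \<in> ?C" for c by (rule range_eqI[of _ _ "[:c:]"]) simp
  have zC: "z n \<in> ?C" by (rule range_eqI[of _ _ "[:0, 1:]"]) simp
  have "\<exists>d\<in>?C. d \<noteq> 0 \<and> d \<in> P"
  proof (rule poisson_prime_contains_scalar[OF P m(2)])
    have uminus: "- poly_at (z n) p = poly_at (z n) (smult (- 1) p)" for p :: "'k poly"
      by (simp only: poly_at_smult Const_uminus Const_1) simp
    have "1 \<in> ?C" using const[of 1] by simp
    then have "closed_ring ?C"
      unfolding closed_ring_def by (auto simp: uminus simp flip: poly_at_add poly_at_mult)
    then show "closed_ring (of_pol ` ?C)"
      unfolding closed_ring_def by (auto simp flip: of_pol_simps intro!: imageI)
    show "base_field \<subseteq> of_pol ` ?C" using const by (auto simp: base_field_def)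
    show "z i \<in> ?C" if "i \<in> {m<..n}" for i
    proof -
      from that m have "i = n" by auto
      then show ?thesis using zC by simp
    qed
    show "L_bracket n c g = 0" if "c \<in> ?C" "g \<in> Fpoly n" for c g
    proof -
      have "L_bracket n (poly_at (z n) p) g = 0" for p
        by (induction p)
           (simp_all add: L_bracket_add L_bracket_Const L_bracket_Leibniz L_bracket_z_self(1) that assms(3) L_bracket_def[of n 0] pd_0)
      then show ?thesis using that by auto
    qed
  qed (use m poisson_prime_z_not_mem[OF P(1)] zC in \<open>auto intro: poly_at_Fpoly\<close>)
  then obtain p where p: "poly_at (z n) p \<in> P" "poly_at (z n) p \<noteq> 0" by blast
  then have "p \<noteq> 0" by auto
  with p(1) show ?thesis
  proof (induction "degree p" arbitrary: p rule: less_induct)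
    case less
    show ?case
    proof (cases "degree p = 0")
      case True
      then obtain a where "p = [:a:]" by (metis degree_eq_zeroE)
      then show ?thesis using less.prems poisson_prime_Const[OF P(1), of a] by simp
    next
      case False
      then obtain c where "poly p c = 0" using alg_closed_imp_poly_has_root[of p] by auto
      then obtain q where q: "p = [:- c, 1:] * q" by (auto simp: poly_eq_0_iff_dvd elim: dvdE)
      have "poly_at (z n) p = (z n - Const c) * poly_at (z n) q"
        unfolding q poly_at_mult by (simp add: Const_uminus)
      then have "z n - Const c \<in> P \<or> poly_at (z n) q \<in> P"
        using less.prems by (intro is_poisson_primeD(11)[OF P(1)] Fpoly_diff poly_at_Fpoly) auto
      moreover have "q \<noteq> 0" using less.prems(2) q by auto
      moreover from this have "degree q < degree p"
        unfolding q by (subst degree_mult_eq) auto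
      ultimately show ?thesis using less.hyps[of q] by blast
    qed
  qed
qed

text \<open>Turns divisibility in the ambient ring into membership in a principal ideal of
  F_n.\<close>

lemma dvd_Fpoly:
  fixes g :: "'k::field_char_0 mpol"
  assumes "g dvd f" "f \<in> Fpoly n" "g \<in> Fpoly n" "g \<noteq> 0"
  shows "\<exists>x\<in>Fpoly n. f = x * g"
proof -
  obtain x where x: "f = g * x" using assms(1) by blast
  then have "x \<in> Fpoly n" using assms by (intro Fpoly_cancel[of g x]) auto
  then show ?thesis using x by (auto simp: mult.commute)
qed

text \<open>\<open>z_pred_division\<close> controls the variables of the remainder only; those of
  the quotient follow by cancelling the divisor in F_(n+1).\<close>

lemma z_pred_division_Fpoly:
  fixes f :: "'k::field_char_0 mpol"
  assumes "f \<in> Fpoly (Suc n)"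
  shows "\<exists>k. \<exists>q\<in>Fpoly (Suc n). \<exists>r\<in>Fpoly n. z n ^ k * f = (z (Suc n) - Const c) * q + r"
proof -
  obtain k q r where *: "z n ^ k * f = (z (Suc n) - Const c) * q + r"
      "\<forall>i. i \<notin> {1..Suc n} - {Suc n} \<longrightarrow> pd i r = 0"
    using z_pred_division[of f "{1..Suc n}" n c] assms by (auto simp: Fpoly_def)
  have r: "r \<in> Fpoly n" unfolding Fpoly_iff_pd using *(2) by auto
  have nz: "z (Suc n) - Const c \<noteq> 0"
  proof
    assume "z (Suc n) - Const c = 0"
    then have "pd (Suc n) (z (Suc n) - Const c) = 0" by (simp add: pd_0)
    then show False by (simp add: pd_diff pd_z_Suc_self del: z.simps)
  qed
  have "(z (Suc n) - Const c) * q = z n ^ k * f - r" using *(1) by simp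
  also have "\<dots> \<in> Fpoly (Suc n)"
    using assms r Fpoly_mono[of n "Suc n"] by (intro Fpoly_diff Fpoly_mult Fpoly_power) auto
  finally have "q \<in> Fpoly (Suc n)"
    by (rule Fpoly_cancel) (use nz in \<open>auto intro: Fpoly_diff\<close>)
  with r *(1) show ?thesis by blast
qed

section \<open>Principal Poisson primes and the case of odd index\<close>

lemma z_diff_Const_Fpoly [intro]: "m \<le> n \<Longrightarrow> z m - Const c \<in> Fpoly n"
  by auto

text \<open>For odd n the generator is central; for even n admissibility forces c = 0, and z_n is
  normal. Primality is that of the generator.\<close>

lemma is_poisson_prime_principal:
  fixes c :: "'k::field_char_0"
  assumes "z_admissible n c"
  shows "is_poisson_prime n {x * (z n - Const c) | x. x \<in> Fpoly n}" (is "is_poisson_prime n ?P")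
proof -
  let ?g = "z n - Const c"
  have pr: "prime_elem ?g" using assms by (rule prime_elem_z_diff_Const)
  then have g0: "?g \<noteq> 0" by auto
  have g: "?g \<in> Fpoly n" by auto
  have mem: "f \<in> ?P \<longleftrightarrow> f \<in> Fpoly n \<and> ?g dvd f" for f
    using dvd_Fpoly[of ?g f n] g0 g by auto
  have br: "?g dvd L_bracket n a b" if a: "?g dvd a" and b: "b \<in> Fpoly n" for a b
  proof -
    from a obtain x where "a = ?g * x" by blast
    then have x: "a = x * ?g" by (simp add: mult.commute)
    obtain h where h: "L_bracket n (z n) b = h * z n" using L_bracket_z_self(2)[OF b] by blast
    have "?g dvd L_bracket n (z n) b"
      using assms h L_bracket_z_self(1)[OF b] by (auto simp: z_admissible_def)
    then show ?thesis
      unfolding x by (simp add: L_bracket_Leibniz L_bracket_diff L_bracket_Const)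
  qed
  show ?thesis
    unfolding is_poisson_prime_def mem
    using br pr by (auto simp: prime_elem_dvd_mult_iff not_prime_unit dest: prime_elem_not_unit)
qed

text \<open>Remainders of elements of P on division by z_n - c lie in the contraction of P to
  F_(n-1). It is zero: otherwise, n - 1 being even, it would contain z_(n-1), which P does not. So
  z_n - c divides a power of z_(n-1) times each element of P, and the power cancels.\<close>

lemma is_poisson_prime_odd_cases:
  fixes P :: "'k::{alg_closed_field, field_char_0} mpol set"
  assumes P: "is_poisson_prime n P" "P \<noteq> {0}" and "odd n"
  shows "\<exists>c. P = {x * (z n - Const c) | x. x \<in> Fpoly n}"
proof -
  obtain c where c: "z n - Const c \<in> P" using poisson_prime_odd_z_mem[OF assms] by blast
  let ?g = "z n - Const c"
  have pr: "prime_elem ?g" using assms(3) by (intro prime_elem_z_diff_Const) (simp add: z_admissible_def)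
  then have g0: "?g \<noteq> 0" by auto
  have g: "?g \<in> Fpoly n" by auto
  obtain m where m: "n = Suc m" "even m" using assms(3) by (cases n) auto
  have "?g dvd f" if f: "f \<in> P" for f
  proof -
    have "f \<in> Fpoly (Suc m)" using is_poisson_primeD(2)[OF P(1) f] m by simp
    from z_pred_division_Fpoly[OF this, of c] obtain k q r where q: "q \<in> Fpoly n" and r: "r \<in> Fpoly m"
      and eq: "z m ^ k * f = ?g * q + r" using m(1) by blast
    have "r = z m ^ k * f - ?g * q" using eq by simp
    also have "\<dots> \<in> P"
      by (rule is_poisson_primeD(7)[OF P(1) is_poisson_primeD(5)[OF P(1) _ f] is_poisson_primeD(6)[OF P(1) c q]])
         (use m in \<open>auto intro!: Fpoly_power\<close>)
    finally have "r \<in> P \<inter> Fpoly m" using r by simp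
    moreover have "P \<inter> Fpoly m = {0}"
    proof (rule ccontr)
      assume "P \<inter> Fpoly m \<noteq> {0}"
      then have "z m \<in> P \<inter> Fpoly m"
        using poisson_prime_even_z_mem[OF poisson_prime_restrict[OF P(1)], of m] m by auto
      then show False using poisson_prime_z_not_mem[OF P(1), of m] m by simp
    qed
    ultimately have "?g dvd z m ^ k * f" using eq by simp
    moreover have "\<not> ?g dvd z m"
    proof
      assume "?g dvd z m"
      then obtain x where "x \<in> Fpoly n" "z m = x * ?g"
        using dvd_Fpoly[of ?g "z m" n] g0 g m by auto
      then have "z m \<in> P" using is_poisson_primeD(5)[OF P(1) _ c] by simp
      then show False using poisson_prime_z_not_mem[OF P(1), of m] m by simp
    qed
    ultimately show "?g dvd f"
      using pr prime_elem_dvd_power[OF pr] by (auto simp: prime_elem_dvd_mult_iff)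
  qed
  then have "P \<subseteq> {x * ?g | x. x \<in> Fpoly n}"
    using dvd_Fpoly[of ?g _ n] g0 g is_poisson_primeD(2)[OF P(1)] by fast
  moreover have "{x * ?g | x. x \<in> Fpoly n} \<subseteq> P"
    using is_poisson_primeD(5)[OF P(1) _ c] by blast
  ultimately show ?thesis by blast
qed

section \<open>The ideals generated by z_(m+1) and z_m - c, and the case of even index\<close>

definition z_pair_ideal :: "nat \<Rightarrow> 'k::field \<Rightarrow> 'k mpol set" where
  "z_pair_ideal m c = {x * z (Suc m) + y * (z m - Const c) | x y. x \<in> Fpoly (Suc m) \<and> y \<in> Fpoly (Suc m)}"

lemma z_pair_idealI: "x \<in> Fpoly (Suc m) \<Longrightarrow> y \<in> Fpoly (Suc m) \<Longrightarrow> x * z (Suc m) + y * (z m - Const c) \<in> z_pair_ideal m c"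
  unfolding z_pair_ideal_def by blast

lemma z_pair_ideal_props:
  shows "z_pair_ideal m c \<subseteq> Fpoly (Suc m)" "0 \<in> z_pair_ideal m c"
    and "\<And>a b. a \<in> z_pair_ideal m c \<Longrightarrow> b \<in> z_pair_ideal m c \<Longrightarrow> a + b \<in> z_pair_ideal m c"
    and "\<And>a b. a \<in> Fpoly (Suc m) \<Longrightarrow> b \<in> z_pair_ideal m c \<Longrightarrow> a * b \<in> z_pair_ideal m c"
    and "z (Suc m) \<in> z_pair_ideal m c" "z m - Const c \<in> z_pair_ideal m c"
proof -
  have *: "z m - Const c \<in> Fpoly (Suc m)" "z (Suc m) \<in> Fpoly (Suc m)" by (auto simp del: z.simps)
  show "z_pair_ideal m c \<subseteq> Fpoly (Suc m)"
    unfolding z_pair_ideal_def using * by (auto simp del: z.simps intro!: Fpoly_add Fpoly_mult)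
  show "0 \<in> z_pair_ideal m c" using z_pair_idealI[of 0 m 0 c] by simp
  show "z (Suc m) \<in> z_pair_ideal m c" using z_pair_idealI[of 1 m 0 c] by simp
  show "z m - Const c \<in> z_pair_ideal m c" using z_pair_idealI[of 0 m 1 c] by simp
  show "a + b \<in> z_pair_ideal m c" if ab: "a \<in> z_pair_ideal m c" "b \<in> z_pair_ideal m c" for a b
  proof -
    from ab obtain x y x' y' where *: "x \<in> Fpoly (Suc m)" "y \<in> Fpoly (Suc m)" "x' \<in> Fpoly (Suc m)" "y' \<in> Fpoly (Suc m)"
      "a = x * z (Suc m) + y * (z m - Const c)" "b = x' * z (Suc m) + y' * (z m - Const c)"
      unfolding z_pair_ideal_def by blast
    have eq: "a + b = (x + x') * z (Suc m) + (y + y') * (z m - Const c)"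
      unfolding * by (simp add: algebra_simps)
    show ?thesis unfolding eq by (rule z_pair_idealI) (use *(1-4) in auto)
  qed
  show "a * b \<in> z_pair_ideal m c" if ab: "a \<in> Fpoly (Suc m)" "b \<in> z_pair_ideal m c" for a b
  proof -
    from ab obtain x y where *: "x \<in> Fpoly (Suc m)" "y \<in> Fpoly (Suc m)"
      "b = x * z (Suc m) + y * (z m - Const c)" unfolding z_pair_ideal_def by blast
    have eq: "a * b = (a * x) * z (Suc m) + (a * y) * (z m - Const c)"
      unfolding * by (simp add: algebra_simps)
    show ?thesis unfolding eq by (rule z_pair_idealI) (use *(1-2) ab(1) in auto)
  qed
qed

text \<open>Modulo the ideal z_m is congruent to c, a unit, so a power of z_m may be replaced by a
  power of c and divided out.\<close>

lemma z_pair_ideal_cancel: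
  assumes f: "f \<in> Fpoly (Suc m)" "z m ^ k * f \<in> z_pair_ideal m c" and "c \<noteq> 0"
  shows "f \<in> z_pair_ideal m c"
proof -
  note J = z_pair_ideal_props[where m = m and c = c]
  \<comment> \<open>The difference of the k-th powers is a multiple of c - z_m; \<open>h\<close>
    varies since the induction absorbs a factor z_m into it.\<close>
  have *: "(Const c ^ k - z m ^ k) * h \<in> z_pair_ideal m c" if "h \<in> Fpoly (Suc m)" for h
    using that
  proof (induction k arbitrary: h)
    case 0
    then show ?case using J(2) by simp
  next
    case (Suc k)
    have "(Const c ^ Suc k - z m ^ Suc k) * h =
        (- (Const c ^ k * h)) * (z m - Const c) + (Const c ^ k - z m ^ k) * (z m * h)"
      by (simp add: algebra_simps)
    moreover have "z m * h \<in> Fpoly (Suc m)" "- (Const c ^ k * h) \<in> Fpoly (Suc m)"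
      using Suc.prems by (auto intro!: Fpoly_mult Fpoly_power)
    ultimately show ?case using Suc.IH J(3,4,6) by metis
  qed
  have "(Const c ^ k - z m ^ k) * f + z m ^ k * f \<in> z_pair_ideal m c"
    by (rule J(3)[OF *[OF f(1)] f(2)])
  then have "Const c ^ k * f \<in> z_pair_ideal m c" by (simp add: algebra_simps)
  then have "Const (inverse c) ^ k * (Const c ^ k * f) \<in> z_pair_ideal m c"
    by (rule J(4)[OF Fpoly_power[OF Fpoly_Const]])
  also have "Const (inverse c) ^ k * (Const c ^ k * f) = f"
    using assms(3) by (simp flip: mult.assoc power_mult_distrib Const_mult)
  finally show ?thesis .
qed

text \<open>Modulo z_m - c the element z_(m+1) is still linear in x_(m+1), with leading coefficient
  congruent to the unit c. Hence a member of the ideal that is free of x_(m+1) needs only the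
  generator z_m - c.\<close>

lemma z_pair_ideal_free:
  fixes c :: "'k::field_char_0"
  assumes "r \<in> z_pair_ideal m c" "pd (Suc m) r = 0" "c \<noteq> 0"
  shows "z m - Const c dvd r"
proof -
  let ?g = "z m - Const c"
  from assms(1) obtain x y where xy: "r = x * z (Suc m) + y * ?g" unfolding z_pair_ideal_def by blast
  show ?thesis
  proof (rule dvd_of_dvd_linear_mult_diff(2)[of ?g "z (Suc m)" x r "Suc m"])
    show "?g dvd z (Suc m) * x - r" unfolding xy by (simp add: mult.commute del: z.simps)
    \<comment> \<open>Regularity of the leading coefficient: z_m b and c b differ by a multiple of
      z_m - c.\<close>
    show "?g dvd b" if "?g dvd pd (Suc m) (z (Suc m)) * b" for b
    proof -
      have "?g dvd z m * b - ?g * b" using that by (simp add: pd_z_Suc_self del: z.simps)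
      then have "?g dvd Const c * b" by (simp add: algebra_simps)
      then have "?g dvd Const (inverse c) * (Const c * b)" by (rule dvd_mult)
      then show ?thesis using assms(3) by (simp flip: mult.assoc Const_mult)
    qed
  qed (use assms(2) in \<open>simp_all add: pd_diff pd_z_eq_0 pd_z_Suc_self del: z.simps\<close>)
qed

text \<open>Division by z_(m+1) replaces two factors by remainders in F_m. Their product lies in the
  ideal and is free of x_(m+1), so it is a multiple of the prime z_m - c. The resulting power of z_m
  is removed by \<open>z_pair_ideal_cancel\<close>.\<close>

lemma is_poisson_prime_z_pair_ideal:
  fixes c :: "'k::field_char_0"
  assumes "odd m" "c \<noteq> 0"
  shows "is_poisson_prime (Suc m) (z_pair_ideal m c)"
proof -
  let ?J = "z_pair_ideal m c" and ?g = "z m - Const c"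
  note J = z_pair_ideal_props[where m = m and c = c]
  have pr: "prime_elem ?g" using assms(1) by (intro prime_elem_z_diff_Const) (simp add: z_admissible_def)
  have dvd_J: "r \<in> ?J" if r: "?g dvd r" "r \<in> Fpoly (Suc m)" for r
  proof -
    have "?g \<noteq> 0" using pr by auto
    then obtain x where "x \<in> Fpoly (Suc m)" "r = x * ?g"
      using dvd_Fpoly[OF r z_diff_Const_Fpoly[of m "Suc m" c]] by auto
    then show ?thesis using J(4)[OF _ J(6)] by simp
  qed
  have br: "L_bracket (Suc m) a b \<in> ?J" if a: "a \<in> ?J" and b: "b \<in> Fpoly (Suc m)" for a b
  proof -
    from a obtain x y where xy: "x \<in> Fpoly (Suc m)" "y \<in> Fpoly (Suc m)" "a = x * z (Suc m) + y * ?g"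
      unfolding z_pair_ideal_def by blast
    have 1: "L_bracket (Suc m) (z (Suc m)) b \<in> ?J"
      using L_bracket_z_self(2)[OF b] J(4,5) by (metis)
    \<comment> \<open>As m is odd, {z_m, x_j} vanishes for j \<le> m and equals z_(m+1) for j = m +
      1. So z_m is central modulo z_(m+1), which is why both generators are needed.\<close>
    have "L_bracket (Suc m) (z m) b = (\<Sum>j=1..Suc m. if j = Suc m then z (Suc m) * pd j b else 0)"
      unfolding L_bracket_expand_right[of "Suc m" "z m" b]
      by (rule sum.cong) (use assms(1) in \<open>auto simp: L_bracket_z_xvar simp del: z.simps\<close>)
    also have "\<dots> = pd (Suc m) b * z (Suc m)" by (simp add: mult.commute del: z.simps)
    also have "\<dots> \<in> ?J" by (rule J(4)[OF _ J(5)]) (use b in auto)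
    finally have 2: "L_bracket (Suc m) ?g b \<in> ?J" by (simp add: L_bracket_diff L_bracket_Const)
    have "L_bracket (Suc m) a b = x * L_bracket (Suc m) (z (Suc m)) b + L_bracket (Suc m) x b * z (Suc m)
        + (y * L_bracket (Suc m) ?g b + L_bracket (Suc m) y b * ?g)"
      unfolding xy by (simp add: L_bracket_add L_bracket_Leibniz del: z.simps)
    then show ?thesis
      using J(3)[OF J(3)[OF J(4)[OF xy(1) 1] J(4)[OF L_bracket_Fpoly[OF xy(1) b] J(5)]]
          J(3)[OF J(4)[OF xy(2) 2] J(4)[OF L_bracket_Fpoly[OF xy(2) b] J(6)]]] by simp
  qed
  have one: "1 \<notin> ?J"
    using z_pair_ideal_free[of 1 m c] assms(2) pr prime_elem_not_unit by (auto simp: pd_1)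
  have prime: "f \<in> ?J \<or> g \<in> ?J" if f: "f \<in> Fpoly (Suc m)" and g: "g \<in> Fpoly (Suc m)" and fg: "f * g \<in> ?J" for f g
  proof -
    from z_pred_division_Fpoly[OF f, of 0] obtain k q r where q: "q \<in> Fpoly (Suc m)" "r \<in> Fpoly m"
      and eq: "z m ^ k * f = z (Suc m) * q + r" by (auto simp del: z.simps)
    from z_pred_division_Fpoly[OF g, of 0] obtain l q' r' where q': "q' \<in> Fpoly (Suc m)" "r' \<in> Fpoly m"
      and eq': "z m ^ l * g = z (Suc m) * q' + r'" by (auto simp del: z.simps)
    note up = subsetD[OF Fpoly_mono[of m "Suc m"]]
    have "r * r' = z m ^ (k + l) * (f * g) + (- (q * (z m ^ l * g) + r * q')) * z (Suc m)"
    proof -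
      have "z m ^ (k + l) * (f * g) = (z m ^ k * f) * (z m ^ l * g)"
        by (simp add: power_add algebra_simps del: z.simps)
      also have "\<dots> = z (Suc m) * (q * (z m ^ l * g) + r * q') + r * r'"
        unfolding eq eq' by (simp add: algebra_simps del: z.simps)
      finally show ?thesis by (simp add: algebra_simps del: z.simps)
    qed
    also have "\<dots> \<in> ?J"
      by (intro J(3) J(4)[OF _ fg] J(4)[OF _ J(5)] Fpoly_uminus Fpoly_add Fpoly_mult Fpoly_power)
         (use f g q q' up in auto)
    finally have "r * r' \<in> ?J" .
    moreover have "pd (Suc m) (r * r') = 0"
      using q(2) q'(2) by (simp add: pd_mult pd_eq_0_of_not_mem)
    ultimately have "?g dvd r * r'" using assms(2) by (intro z_pair_ideal_free)
    then have "?g dvd r \<or> ?g dvd r'" using pr by (simp add: prime_elem_dvd_mult_iff)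
    then show ?thesis
    proof
      assume "?g dvd r"
      then have "r \<in> ?J" using q(2) up by (intro dvd_J) auto
      then have "z m ^ k * f \<in> ?J"
        unfolding eq using J(3)[OF J(4)[OF q(1) J(5)]] by (simp add: mult.commute del: z.simps)
      then show ?thesis using z_pair_ideal_cancel[OF f _ assms(2)] by blast
    next
      assume "?g dvd r'"
      then have "r' \<in> ?J" using q'(2) up by (intro dvd_J) auto
      then have "z m ^ l * g \<in> ?J"
        unfolding eq' using J(3)[OF J(4)[OF q'(1) J(5)]] by (simp add: mult.commute del: z.simps)
      then show ?thesis using z_pair_ideal_cancel[OF g _ assms(2)] by blast
    qed
  qed
  show ?thesis
    unfolding is_poisson_prime_def using J br one prime by (simp del: z.simps)
qed

text \<open>z_(m+1) lies in P. If it does not generate P, division by it leaves nonzero remainders,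
  so the contraction to F_m is a nonzero Poisson prime of odd index, generated by some z_m - c. Here
  c is nonzero because z_m is not in P.\<close>

lemma is_poisson_prime_even_cases:
  fixes P :: "'k::{alg_closed_field, field_char_0} mpol set"
  assumes P: "is_poisson_prime (Suc m) P" "P \<noteq> {0}" and "odd m"
  shows "P = {x * z (Suc m) | x. x \<in> Fpoly (Suc m)} \<or> (\<exists>c. c \<noteq> 0 \<and> P = z_pair_ideal m c)"
proof -
  have zP: "z (Suc m) \<in> P" using poisson_prime_even_z_mem[OF P] assms(3) by simp
  show ?thesis
  proof (cases "\<forall>f\<in>P. z (Suc m) dvd f")
    case True
    have "P \<subseteq> {x * z (Suc m) | x. x \<in> Fpoly (Suc m)}"
    proof
      fix f assume f: "f \<in> P"
      have "\<exists>x\<in>Fpoly (Suc m). f = x * z (Suc m)"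
        by (rule dvd_Fpoly) (use True f is_poisson_primeD(2)[OF P(1) f] in \<open>simp_all del: z.simps\<close>)
      then show "f \<in> {x * z (Suc m) | x. x \<in> Fpoly (Suc m)}" by blast
    qed
    moreover have "{x * z (Suc m) | x. x \<in> Fpoly (Suc m)} \<subseteq> P"
      using is_poisson_primeD(5)[OF P(1) _ zP] by blast
    ultimately show ?thesis by blast
  next
    case False
    have zm: "z m \<notin> P" using poisson_prime_z_not_mem[OF P(1), of m] by simp
    have pr: "prime_elem (z (Suc m) :: 'k mpol)"
      using prime_elem_z_diff_Const[of "Suc m" "0 :: 'k"] by (simp add: z_admissible_def del: z.simps)
    have rem: "\<exists>k. \<exists>q\<in>Fpoly (Suc m). \<exists>r\<in>P \<inter> Fpoly m. z m ^ k * f = z (Suc m) * q + r" if f: "f \<in> P" for f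
    proof -
      from z_pred_division_Fpoly[OF is_poisson_primeD(2)[OF P(1) f], of 0]
      obtain k q r where q: "q \<in> Fpoly (Suc m)" "r \<in> Fpoly m"
        and eq: "z m ^ k * f = z (Suc m) * q + r" by (auto simp del: z.simps)
      have "r = z m ^ k * f - z (Suc m) * q" using eq by simp
      also have "\<dots> \<in> P"
        by (rule is_poisson_primeD(7)[OF P(1) is_poisson_primeD(5)[OF P(1) _ f] is_poisson_primeD(6)[OF P(1) zP q(1)]]) (auto intro!: Fpoly_power)
      finally have "r \<in> P \<inter> Fpoly m" using q(2) by simp
      with q(1) eq show ?thesis by blast
    qed
    have "P \<inter> Fpoly m \<noteq> {0}"
    proof
      assume 0: "P \<inter> Fpoly m = {0}"
      from False obtain f where f: "f \<in> P" "\<not> z (Suc m) dvd f" by blast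
      from rem[OF f(1)] obtain k q where "z m ^ k * f = z (Suc m) * q"
        unfolding 0 by (auto simp del: z.simps)
      then have "z (Suc m) dvd z m ^ k * f" by simp
      then have "z (Suc m) dvd (z m :: 'k mpol)"
        using f pr prime_elem_dvd_power[OF pr] by (auto simp: prime_elem_dvd_mult_iff simp del: z.simps)
      then obtain x :: "'k mpol" where "x \<in> Fpoly (Suc m)" "z m = x * z (Suc m)"
        using dvd_Fpoly[of "z (Suc m)" "z m" "Suc m"] by (auto simp del: z.simps)
      then show False using is_poisson_primeD(5)[OF P(1) _ zP] zm by simp
    qed
    then have "\<exists>c. P \<inter> Fpoly m = {x * (z m - Const c) | x. x \<in> Fpoly m}"
      by (intro is_poisson_prime_odd_cases poisson_prime_restrict[OF P(1)] assms(3)) simp_all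
    then obtain c where c: "P \<inter> Fpoly m = {x * (z m - Const c) | x. x \<in> Fpoly m}" ..
    have "1 * (z m - Const c) \<in> P \<inter> Fpoly m" unfolding c by blast
    then have gP: "z m - Const c \<in> P" by simp
    then have c0: "c \<noteq> 0" using zm by auto
    note J = z_pair_ideal_props[where m = m and c = c]
    have "P = z_pair_ideal m c"
    proof
      show "z_pair_ideal m c \<subseteq> P"
      proof
        fix f assume "f \<in> z_pair_ideal m c"
        then obtain x y where "x \<in> Fpoly (Suc m)" "y \<in> Fpoly (Suc m)" "f = x * z (Suc m) + y * (z m - Const c)"
          unfolding z_pair_ideal_def by blast
        then show "f \<in> P"
          using is_poisson_primeD(4)[OF P(1) is_poisson_primeD(5)[OF P(1) _ zP] is_poisson_primeD(5)[OF P(1) _ gP]] by simp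
      qed
      show "P \<subseteq> z_pair_ideal m c"
      proof
        fix f assume f: "f \<in> P"
        from rem[OF f] obtain k q r where q: "q \<in> Fpoly (Suc m)" "r \<in> P \<inter> Fpoly m"
          and eq: "z m ^ k * f = z (Suc m) * q + r" by blast
        obtain x where x: "x \<in> Fpoly m" "r = x * (z m - Const c)" using q(2) unfolding c by blast
        have "x \<in> Fpoly (Suc m)" using x(1) Fpoly_mono[of m "Suc m"] by auto
        then have "z m ^ k * f \<in> z_pair_ideal m c"
          unfolding eq x(2) using z_pair_idealI[OF q(1), of x c] by (simp add: mult.commute del: z.simps)
        then show "f \<in> z_pair_ideal m c"
          using z_pair_ideal_cancel[OF is_poisson_primeD(2)[OF P(1) f] _ c0] by blast
      qed
    qed
    with c0 show ?thesis by blast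
  qed
qed

section \<open>The localization\<close>

lemma T_L_iff: "f \<in> T_L n \<longleftrightarrow> (\<exists>p\<in>Fpoly n. \<exists>s\<in>z_monoid n. f * of_pol s = of_pol p)"
proof
  assume "f \<in> T_L n"
  then obtain p s where *: "p \<in> Fpoly n" "s \<in> z_monoid n" "f = Fract p s" by (auto simp: T_L_def)
  have "of_pol s \<noteq> 0" using z_monoid_nonzero[OF *(2)] by (simp add: of_pol_eq_0_iff)
  from nonzero_eq_divide_eq[OF this] have "f * of_pol s = of_pol p"
    using *(3) Fract_conv_of_pol[of p s] by blast
  with * show "\<exists>p\<in>Fpoly n. \<exists>s\<in>z_monoid n. f * of_pol s = of_pol p" by blast
next
  assume "\<exists>p\<in>Fpoly n. \<exists>s\<in>z_monoid n. f * of_pol s = of_pol p"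
  then obtain p s where *: "p \<in> Fpoly n" "s \<in> z_monoid n" "f * of_pol s = of_pol p" by blast
  have "of_pol s \<noteq> 0" using z_monoid_nonzero[OF *(2)] by (simp add: of_pol_eq_0_iff)
  from nonzero_eq_divide_eq[OF this] have "f = Fract p s"
    using *(3) Fract_conv_of_pol[of p s] by metis
  with * show "f \<in> T_L n" by (auto simp: T_L_def)
qed

lemma T_LI: "p \<in> Fpoly n \<Longrightarrow> s \<in> z_monoid n \<Longrightarrow> f * of_pol s = of_pol p \<Longrightarrow> f \<in> T_L n"
  unfolding T_L_iff by blast

lemma T_L_of_pol: "p \<in> Fpoly n \<Longrightarrow> of_pol p \<in> T_L n"
  by (rule T_LI[OF _ z_monoid_one]) (assumption, simp only: of_pol_simps mult_1_right)

lemma closed_ring_T_L: "closed_ring (T_L n)"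
  unfolding closed_ring_def
proof (intro conjI ballI)
  show "1 \<in> T_L n" using T_L_of_pol[OF Fpoly_1, of n] by (simp only: of_pol_simps)
  fix f g :: "'a mpol fract" assume f: "f \<in> T_L n" and g: "g \<in> T_L n"
  from f obtain p s where p: "p \<in> Fpoly n" "s \<in> z_monoid n" "f * of_pol s = of_pol p" unfolding T_L_iff by blast
  from g obtain q t where q: "q \<in> Fpoly n" "t \<in> z_monoid n" "g * of_pol t = of_pol q" unfolding T_L_iff by blast
  show "- f \<in> T_L n"
    by (rule T_LI[OF Fpoly_uminus[OF p(1)] p(2)]) (simp only: of_pol_simps mult_minus_left p(3))
  have st: "s * t \<in> z_monoid n" using p q z_monoid_mult by blast
  have "(f + g) * of_pol (s * t) = (f * of_pol s) * of_pol t + (g * of_pol t) * of_pol s"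
    by (simp only: of_pol_simps) (simp only: algebra_simps)
  also have "\<dots> = of_pol (p * t + q * s)" by (simp only: of_pol_simps p q)
  finally have eq: "(f + g) * of_pol (s * t) = of_pol (p * t + q * s)" .
  show "f + g \<in> T_L n"
    by (rule T_LI[OF _ st eq]) (use p(1) q(1) z_monoid_Fpoly[OF p(2) order_refl] z_monoid_Fpoly[OF q(2) order_refl] in auto)
  have "(f * g) * of_pol (s * t) = (f * of_pol s) * (g * of_pol t)"
    by (simp only: of_pol_simps) (simp only: ac_simps)
  also have "\<dots> = of_pol (p * q)" by (simp only: of_pol_simps p q)
  finally have eq: "(f * g) * of_pol (s * t) = of_pol (p * q)" .
  show "f * g \<in> T_L n"
    by (rule T_LI[OF _ st eq]) (use p q in auto)
qed

lemma base_field_T_L: "base_field \<subseteq> T_L n"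
  unfolding base_field_def using T_L_of_pol[OF Fpoly_Const] by blast

lemma zf_T_L: "i \<le> n \<Longrightarrow> zf i \<in> T_L n"
  unfolding zf_def by (rule T_L_of_pol) simp

lemma inverse_zf_T_L: "i \<in> {1..n} \<Longrightarrow> inverse (zf i) \<in> T_L n"
  by (rule T_LI[OF Fpoly_1 z_monoid_z]) (simp_all only: flip: zf_def, simp add: fract_collapse)

text \<open>Minimality of T_n among subrings: the form in which it is compared with the span of the
  Laurent monomials, with U and with the Laurent polynomials in the last variable.\<close>

lemma T_L_subset:
  assumes S: "closed_ring S" "base_field \<subseteq> S"
    and zf: "\<And>i. i \<in> {1..n} \<Longrightarrow> zf i \<in> S" and inv: "\<And>i. i \<in> {1..n} \<Longrightarrow> inverse (zf i) \<in> S"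
  shows "T_L n \<subseteq> S"
proof
  fix f :: "'a mpol fract" assume "f \<in> T_L n"
  then obtain p e where p: "p \<in> Fpoly n" and f: "f = Fract p (\<Prod>i=1..n. z i ^ e i)"
    by (auto simp: T_L_def z_monoid_def)
  have "f = of_pol p * (\<Prod>i=1..n. inverse (zf i) ^ e i)"
    unfolding f Fract_conv_of_pol[of p "\<Prod>i=1..n. z i ^ e i"] of_pol_prod of_pol_power zf_def divide_inverse
    by (simp only: prod_inversef[symmetric] power_inverse comp_def)
  moreover have "of_pol p \<in> S"
    by (rule of_pol_mem_ring[OF S _ _ p]) (use zf inv in auto)
  ultimately show "f \<in> S"
    using inv by (auto intro!: closed_ringD[OF S(1)] closed_ring_prod[OF S(1)] closed_ring_power[OF S(1)])
qed

lemma T_L_mono: "m \<le> n \<Longrightarrow> T_L m \<subseteq> T_L n"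
  by (rule T_L_subset[OF closed_ring_T_L base_field_T_L]) (auto intro: zf_T_L inverse_zf_T_L)

lemma fpd_T_L:
  assumes "f \<in> T_L n" shows "fpd i f \<in> T_L n"
proof -
  from assms obtain p s where *: "p \<in> Fpoly n" "s \<in> z_monoid n" "f = Fract p s" by (auto simp: T_L_def)
  have "fpd i f = Fract (pd i p * s - p * pd i s) (s * s)"
    unfolding *(3) by (rule fpd_Fract) (rule z_monoid_nonzero[OF *(2)])
  moreover have "pd i p * s - p * pd i s \<in> Fpoly n"
    using *(1) z_monoid_Fpoly[OF *(2) order_refl] by (auto intro!: Fpoly_diff Fpoly_mult Fpoly_pd)
  ultimately show ?thesis using z_monoid_mult[OF *(2) *(2)] unfolding T_L_def by blast
qed

lemma fpd_T_L_eq_0: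
  assumes "f \<in> T_L n" "i \<notin> {1..n}" shows "fpd i f = 0"
proof -
  from assms(1) obtain p s where *: "p \<in> Fpoly n" "s \<in> z_monoid n" "f = Fract p s" by (auto simp: T_L_def)
  have "fpd i f = Fract (pd i p * s - p * pd i s) (s * s)"
    unfolding *(3) by (rule fpd_Fract) (rule z_monoid_nonzero[OF *(2)])
  moreover have "pd i p = 0" "pd i s = 0"
    using *(1) z_monoid_Fpoly[OF *(2) order_refl] assms(2) by (auto intro: pd_eq_0_of_not_mem)
  ultimately show ?thesis by (simp add: fract_collapse)
qed

lemma L_fbracket_T_L:
  assumes "f \<in> T_L n" "g \<in> T_L n" shows "L_fbracket n f g \<in> T_L n"
  unfolding L_fbracket_def using assms
  by (intro closed_ring_sum[OF closed_ring_T_L] closed_ringD(5)[OF closed_ring_T_L] T_L_of_pol L_gen_Fpoly fpd_T_L) auto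

lemma L_fbracket_restrict:
  assumes "f \<in> T_L m" "g \<in> T_L m" "m \<le> n"
  shows "L_fbracket n f g = L_fbracket m f g"
proof -
  have "L_fbracket n f g = (\<Sum>i=1..n. \<Sum>j=1..m. of_pol (L_gen i j) * fpd i f * fpd j g)"
    unfolding L_fbracket_def
    by (intro sum.cong refl sum.mono_neutral_right) (use assms in \<open>auto simp: fpd_T_L_eq_0\<close>)
  also have "\<dots> = L_fbracket m f g"
    unfolding L_fbracket_def
    by (intro sum.mono_neutral_right) (use assms in \<open>auto simp: fpd_T_L_eq_0\<close>)
  finally show ?thesis .
qed

lemma T_L_torus:
  "T_L n \<subseteq> span_over base_field (z_mono n ` z_exps n)" (is "_ \<subseteq> ?S")
proof (rule T_L_subset)
  show "closed_ring ?S" by (rule closed_ring_torus[OF closed_ring_base_field])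
  have pol: "of_pol p \<in> ?S" if "p \<in> Fpoly n" for p
    by (rule of_pol_mem_torus[OF closed_ring_base_field order_refl _ _ that]) auto
  show "base_field \<subseteq> ?S" unfolding base_field_def using pol[OF Fpoly_Const] by (auto simp: base_field_def)
  show "zf i \<in> ?S" if "i \<in> {1..n}" for i
    unfolding zf_def using that by (intro pol) auto
  show "inverse (zf i) \<in> ?S" if "i \<in> {1..n}" for i
    using span_over_term[OF closed_ringD(2)[OF closed_ring_base_field] z_mono_zf[OF that, of "- 1"]]
    by (simp add: power_int_minus)
qed

lemma poisson_simple_T_L:
  assumes "even n"
  shows "poisson_simple (L_fbracket n) (T_L n :: 'k::field_char_0 mpol fract set)"
proof -
  let ?T = "T_L n :: 'k mpol fract set"
  note T = closed_ringD[OF closed_ring_T_L[of n]]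
  note id = ideal_ring_on_iff[OF closed_ring_T_L[of n]]
  have "I = {0} \<or> I = ?T" if "poisson_ideal (L_fbracket n) ?T I" for I
  proof (rule ccontr)
    assume neg: "\<not> ?thesis"
    have I: "I \<subseteq> ?T" "0 \<in> I" "\<And>a b. a \<in> I \<Longrightarrow> b \<in> I \<Longrightarrow> a + b \<in> I"
        "\<And>a b. a \<in> ?T \<Longrightarrow> b \<in> I \<Longrightarrow> a * b \<in> I" "\<And>a b. a \<in> I \<Longrightarrow> b \<in> ?T \<Longrightarrow> L_fbracket n a b \<in> I"
      using that by (simp_all add: poisson_ideal_def id)
    obtain f where f: "f \<in> I" "f \<noteq> 0" using neg I(2) by blast
    have "\<exists>d\<in>base_field. d \<noteq> 0 \<and> d \<in> I"
    proof (rule torus_reduction[OF assms order_refl closed_ring_base_field order_refl])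
      show "L_fbracket n c (zf j) = 0" if "c \<in> base_field" for c j
        using that by (auto simp: base_field_def L_fbracket_Const)
      show "c * f \<in> I" if "c \<in> base_field" "f \<in> I" for c f
        using that base_field_T_L by (intro I(4)) auto
      show "f \<in> span_over base_field (z_mono n ` z_exps n)" using T_L_torus f I(1) by blast
      show "zf i * f \<in> I" "inverse (zf i) * f \<in> I" "L_fbracket n f (zf i) \<in> I"
        if "i \<in> {1..n}" "f \<in> I" for i f
        using that by (auto intro!: I(4)[OF zf_T_L] I(4)[OF inverse_zf_T_L] I(5)[OF _ zf_T_L])
    qed (use f I(3) in auto)
    then obtain c where c: "c \<noteq> 0" "of_pol (Const c) \<in> I"
      by (auto simp: base_field_def of_pol_eq_0_iff)
    have "of_pol (Const (inverse c)) * of_pol (Const c) \<in> I"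
      by (rule I(4)[OF T_L_of_pol[OF Fpoly_Const] c(2)])
    also have "of_pol (Const (inverse c)) * of_pol (Const c) = of_pol (Const (inverse c * c))"
      by (simp only: of_pol_simps Const_mult)
    also have "\<dots> = 1" using c(1) by (simp add: fract_collapse)
    finally have "a * 1 \<in> I" if "a \<in> ?T" for a using I(4) that by blast
    then have "I = ?T" using I(1) by auto
    with neg show False by blast
  qed
  moreover have "poisson_ideal (L_fbracket n) ?T {0}"
  proof -
    have "L_fbracket n 0 b = 0" for b :: "'k mpol fract"
      using L_fbracket_Const[of n 0 b] by (simp add: fract_collapse)
    then show ?thesis using T by (simp add: poisson_ideal_def id)
  qed
  moreover have "poisson_ideal (L_fbracket n) ?T ?T"
    by (auto simp: poisson_ideal_def id intro: T L_fbracket_T_L)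
  moreover have "?T \<noteq> {0}" using T(2) by (metis singletonD zero_neq_one)
  ultimately show ?thesis unfolding poisson_simple_def by blast
qed

text \<open>Identifies U with the localization one index lower, so that its simplicity for odd n is
  the even case.\<close>

lemma U_L_eq_T_L:
  assumes "n \<ge> 1" shows "U_L n = (T_L (n - 1) :: 'k::field mpol fract set)"
proof
  let ?H = "base_field \<union> zf ` {1..n-1} \<union> (\<lambda>i. inverse (zf i)) ` {1..n-1} :: 'k mpol fract set"
  interpret cring "ring_on (UNIV :: 'k mpol fract set)"
    by (rule cring_ring_on) (simp add: closed_ring_def)
  have "closed_ring (U_L n :: 'k mpol fract set)"
    unfolding closed_ring_iff_subring U_L_def by (rule generate_ring_is_subring) simp
  then show "T_L (n - 1) \<subseteq> (U_L n :: 'k mpol fract set)"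
    unfolding U_L_def by (rule T_L_subset) (auto intro: generate_ring.incl)
  have neg: "\<ominus>\<^bsub>ring_on UNIV\<^esub> a = - a" for a :: "'k mpol fract"
    by (rule minus_equality) auto
  note T = closed_ringD[OF closed_ring_T_L[of "n - 1"]]
  show "U_L n \<subseteq> (T_L (n - 1) :: 'k mpol fract set)"
  proof
    fix f :: "'k mpol fract" assume "f \<in> U_L n"
    then show "f \<in> T_L (n - 1)"
      unfolding U_L_def
    proof induction
      case (incl h)
      then show ?case by (auto intro: zf_T_L inverse_zf_T_L subsetD[OF base_field_T_L])
    qed (use T in \<open>auto simp: neg\<close>)
  qed
qed

section \<open>T_(m+1) as a Laurent polynomial ring over T_m\<close>

lemma fpd_zf_powi:
  "zf (Suc m) * fpd (Suc m) ((zf (Suc m) :: 'k::field mpol fract) powi k) = zf m * (of_int k * zf (Suc m) powi k)"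
proof -
  have "fpd (Suc m) (zf (Suc m) :: 'k mpol fract) = zf m" unfolding zf_def fpd_of_pol pd_z_Suc_self ..
  then have "fpd (Suc m) (zf (Suc m) :: 'k mpol fract) = zf m / zf (Suc m) * zf (Suc m)" by simp
  then have "fpd (Suc m) ((zf (Suc m) :: 'k mpol fract) powi k) = of_int k * (zf m / zf (Suc m)) * zf (Suc m) powi k"
    by (intro derivation_powi) (auto simp: fpd_mult)
  then show ?thesis by simp
qed

text \<open>Linear independence of the powers of \<open>z\<^sub>m\<^sub>+\<^sub>1\<close> over \<open>T\<^sub>m\<close>: they are eigenvectors of the
  \<open>T\<^sub>m\<close>-linear derivation \<open>(z\<^sub>m\<^sub>+\<^sub>1 / z\<^sub>m) \<partial>\<^sub>m\<^sub>+\<^sub>1\<close> with distinct eigenvalues.\<close>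

lemma zf_powi_independent:
  fixes c :: "int \<Rightarrow> 'k::field_char_0 mpol fract"
  assumes S: "finite S" and c: "\<And>k. k \<in> S \<Longrightarrow> c k \<in> T_L m" and 0: "(\<Sum>k\<in>S. c k * zf (Suc m) powi k) = 0"
    and k: "k \<in> S"
  shows "c k = 0"
proof (rule ccontr)
  assume nz: "c k \<noteq> 0"
  define S' where "S' = {k \<in> S. c k \<noteq> 0}"
  \<comment> \<open>The reduction is run with the zero ideal: a vanishing sum with nonzero
    coefficients would produce a nonzero element of \<open>{0}\<close>.\<close>
  have "\<exists>d\<in>T_L m. d \<noteq> 0 \<and> d \<in> {0 :: 'k mpol fract}"
  proof (rule eigenvector_reduction[where E = UNIV and J = "{()}" and e = "\<lambda>k. zf (Suc m) powi k"
        and T = "\<lambda>_ f. zf (Suc m) * fpd (Suc m) f / zf m" and w = "\<lambda>_ k. of_int k" and S = S' and c = c])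
    show "closed_ring (T_L m)" by (rule closed_ring_T_L)
    show "zf (Suc m) * fpd (Suc m) f / zf m \<in> {0}" if "f \<in> {0}" for f :: "'k mpol fract"
      using that fpd_Const[of "Suc m" 0] by (simp add: fract_collapse)
    show "zf (Suc m) * fpd (Suc m) (c * zf (Suc m) powi k) / zf m = c * of_int k * zf (Suc m) powi k"
      if "c \<in> T_L m" for c k
      using that by (simp add: fpd_mult fpd_T_L_eq_0[of c m] mult.left_commute[of _ c] fpd_zf_powi)
    show "of_int k \<in> T_L m" for k using base_field_T_L of_int_in_base_field by blast
    show "(\<Sum>a\<in>S'. c a * zf (Suc m) powi a) \<in> {0}"
    proof -
      have "(\<Sum>a\<in>S'. c a * zf (Suc m) powi a) = (\<Sum>a\<in>S. c a * zf (Suc m) powi a)"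
        by (rule sum.mono_neutral_left) (use S in \<open>auto simp: S'_def\<close>)
      then show ?thesis using 0 by simp
    qed
  qed (use S c k nz in \<open>auto simp: S'_def fpd_add field_simps of_int_eq_iff_fract\<close>)
  then show False by blast
qed

lemma laurent_eval_superset:
  assumes "finite S" "Poly_Mapping.keys p \<subseteq> S"
  shows "laurent_eval y p = (\<Sum>k\<in>S. Poly_Mapping.lookup p k * y powi k)"
  unfolding laurent_eval_def
  by (rule sum.mono_neutral_left) (use assms in \<open>auto simp: in_keys_iff\<close>)

text \<open>Injectivity is the independence of the powers of z_(m+1). Surjectivity holds because
  their span over T_m is a ring containing the generators of T_(m+1) and their inverses.\<close>

lemma is_laurent_ring_T_L:
  "is_laurent_ring (T_L (Suc m) :: 'k::field_char_0 mpol fract set) (T_L m) (zf (Suc m))"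
  unfolding is_laurent_ring_def bij_betw_def
proof (intro conjI)
  let ?T = "T_L (Suc m) :: 'k mpol fract set" and ?y = "zf (Suc m) :: 'k mpol fract"
  let ?L = "{p. \<forall>k. Poly_Mapping.lookup p k \<in> (T_L m :: 'k mpol fract set)}"
  note T = closed_ring_T_L[of "Suc m"]
  note Tm = closed_ringD[OF closed_ring_T_L[of m]]
  show "?y \<noteq> 0" by simp
  show "inj_on (laurent_eval ?y) ?L"
  proof (rule inj_onI)
    fix p q assume p: "p \<in> ?L" and q: "q \<in> ?L" and eq: "laurent_eval ?y p = laurent_eval ?y q"
    let ?S = "Poly_Mapping.keys p \<union> Poly_Mapping.keys q"
    have "(\<Sum>k\<in>?S. (Poly_Mapping.lookup p k - Poly_Mapping.lookup q k) * ?y powi k) =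
        laurent_eval ?y p - laurent_eval ?y q"
      by (simp add: laurent_eval_superset[of ?S] left_diff_distrib sum_subtractf)
    then have "(\<Sum>k\<in>?S. (Poly_Mapping.lookup p k - Poly_Mapping.lookup q k) * ?y powi k) = 0"
      using eq by simp
    then have "Poly_Mapping.lookup p k - Poly_Mapping.lookup q k = 0" if "k \<in> ?S" for k
      by (intro zf_powi_independent[where S = ?S and m = m and c = "\<lambda>k. Poly_Mapping.lookup p k - Poly_Mapping.lookup q k"])
         (use p q that in \<open>auto intro!: Tm\<close>)
    then show "p = q" by (intro poly_mapping_eqI) (metis UnCI in_keys_iff eq_iff_diff_eq_0)
  qed
  have powi: "?y powi k \<in> ?T" for k
    by (rule closed_ring_powi[OF T]) (auto intro: zf_T_L inverse_zf_T_L)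
  show "laurent_eval ?y ` ?L = ?T"
  proof
    show "laurent_eval ?y ` ?L \<subseteq> ?T"
      using T_L_mono[of m "Suc m"] powi
      by (auto simp: laurent_eval_def intro!: closed_ring_sum[OF T] closed_ringD(5)[OF T])
    let ?S = "span_over (T_L m) ((powi) ?y ` UNIV)"
    have "?T \<subseteq> ?S"
    proof (rule T_L_subset)
      have one: "?y powi 0 \<in> (powi) ?y ` UNIV" by (rule imageI) simp
      show "closed_ring ?S"
      proof (rule closed_ring_span_over[OF closed_ring_T_L])
        show "1 \<in> (powi) ?y ` UNIV" using one by simp
        show "a * b \<in> (powi) ?y ` UNIV" if "a \<in> (powi) ?y ` UNIV" "b \<in> (powi) ?y ` UNIV" for a b
          using that by (auto simp flip: power_int_add)
      qed
      have sub: "c \<in> ?S" if "c \<in> T_L m" for c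
        using span_over_term[OF that one] by simp
      have powiS: "?y powi k \<in> ?S" for k
        using span_over_term[OF Tm(2), of "?y powi k" "(powi) ?y ` UNIV"] by simp
      show "base_field \<subseteq> ?S" using sub base_field_T_L by blast
      show "zf i \<in> ?S" if "i \<in> {1..Suc m}" for i
        using powiS[of 1] sub[OF zf_T_L[of i m]] that by (cases "i = Suc m") auto
      show "inverse (zf i) \<in> ?S" if "i \<in> {1..Suc m}" for i
        using powiS[of "- 1"] sub[OF inverse_zf_T_L[of i m]] that by (cases "i = Suc m") (auto simp: power_int_minus)
    qed
    moreover have "?S \<subseteq> laurent_eval ?y ` ?L"
    proof
      fix f assume "f \<in> ?S"
      then obtain S c where S: "finite S" "\<forall>a. c a \<in> T_L m" "f = (\<Sum>k\<in>S. c k * ?y powi k)"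
        using span_over_finite_sum[OF closed_ring_T_L, of f m "(powi) ?y" UNIV] by blast
      \<comment> \<open>The coefficients are cut off outside \<open>S\<close>, where
        \<open>c\<close> is arbitrary, to obtain a finite support.\<close>
      define p where "p = Poly_Mapping.Abs_poly_mapping (\<lambda>k. if k \<in> S then c k else 0)"
      have lk: "Poly_Mapping.lookup p = (\<lambda>k. if k \<in> S then c k else 0)"
        unfolding p_def using S(1) by (intro Abs_poly_mapping_inverse) (auto elim: finite_subset[rotated])
      have "Poly_Mapping.keys p \<subseteq> S" by (auto simp: in_keys_iff lk split: if_splits)
      then have "laurent_eval ?y p = f"
        unfolding S(3) by (subst laurent_eval_superset[OF S(1)]) (auto simp: lk intro!: sum.cong)
      moreover have "p \<in> ?L" using S(2) Tm by (auto simp: lk)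
      ultimately show "f \<in> laurent_eval ?y ` ?L" by blast
    qed
    ultimately show "?T \<subseteq> laurent_eval ?y ` ?L" by blast
  qed
qed

text \<open>Centrality passes from F_n to fractions: in the Leibniz rule for f s = p the brackets of
  p and s with z_n vanish, leaving {f, z_n} s = 0.\<close>

lemma poisson_central_zf:
  assumes "odd n" shows "poisson_central (L_fbracket n) (T_L n) (zf n)"
  unfolding poisson_central_def
proof (intro conjI ballI)
  show "zf n \<in> T_L n" by (rule zf_T_L) simp
  fix f :: "'a mpol fract" assume "f \<in> T_L n"
  then obtain p s where p: "p \<in> Fpoly n" "s \<in> z_monoid n" "f * of_pol s = of_pol p" unfolding T_L_iff by blast
  have 0: "L_fbracket n (of_pol g) (zf n) = 0" if "g \<in> Fpoly n" for g
    using L_bracket_z_self(1)[OF that assms] L_bracket_antisym[of n g "z n"]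
    by (simp add: zf_def L_fbracket_of_pol fract_collapse)
  have "L_fbracket n (f * of_pol s) (zf n) = 0" unfolding p(3) using p(1) by (rule 0)
  then have "L_fbracket n f (zf n) * of_pol s = 0"
    unfolding L_fbracket_Leibniz 0[OF z_monoid_Fpoly[OF p(2) order_refl]] by simp
  then have "L_fbracket n f (zf n) = 0"
    using z_monoid_nonzero[OF p(2)] by (simp add: of_pol_eq_0_iff)
  then show "L_fbracket n (zf n) f = 0" using L_fbracket_antisym[of n "zf n" f] by simp
qed

text \<open>U carries the bracket of T_n, whereas its simplicity is known for the bracket of
  T_(n-1).\<close>

lemma poisson_simple_cong:
  assumes "\<And>a b. a \<in> A \<Longrightarrow> b \<in> A \<Longrightarrow> br a b = br' a b" "closed_ring A"
  shows "poisson_simple br A \<longleftrightarrow> poisson_simple br' A"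
proof -
  have "poisson_ideal br A I \<longleftrightarrow> poisson_ideal br' A I" for I
    using assms(1) by (auto simp: poisson_ideal_def ideal_ring_on_iff[OF assms(2)] subset_iff)
  then show ?thesis by (simp add: poisson_simple_def)
qed

lemma PIdl_ring_on: "PIdl\<^bsub>ring_on A\<^esub> a = {x * a | x. x \<in> A}"
  by (simp add: cgenideal_def)

lemma z_pair_ideal_eq_sum:
  "PIdl\<^bsub>ring_on (Fpoly (Suc m))\<^esub> (z (Suc m)) <+>\<^bsub>ring_on (Fpoly (Suc m))\<^esub>
     PIdl\<^bsub>ring_on (Fpoly (Suc m))\<^esub> (z m - Const c) = z_pair_ideal m c"
  unfolding PIdl_ring_on set_add_def' z_pair_ideal_def by (auto simp del: z.simps)

theorem proposition7p7:
  fixes n :: nat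
  assumes "n \<ge> 2"
  shows
    "(even n \<longrightarrow>
       poisson_simple (L_fbracket n) (T_L n :: 'k::{alg_closed_field, field_char_0} mpol fract set))
   \<and> (odd n \<longrightarrow>
       is_laurent_ring (T_L n :: 'k mpol fract set) (U_L n) (zf n) \<and>
       poisson_subalgebra base_field (L_fbracket n) (T_L n :: 'k mpol fract set) (U_L n) \<and>
       poisson_simple (L_fbracket n) (U_L n :: 'k mpol fract set) \<and>
       poisson_central (L_fbracket n) (T_L n) (zf n :: 'k mpol fract))
   \<and> (odd n \<longrightarrow>
       {P. poisson_prime_ideal (L_bracket n) (Fpoly n) P \<and> P \<noteq> {0}} =
       {PIdl\<^bsub>ring_on (Fpoly n)\<^esub> (z n - Const c :: 'k mpol) | c. True})
   \<and> (even n \<longrightarrow>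
       {P. poisson_prime_ideal (L_bracket n) (Fpoly n) P \<and> P \<noteq> {0}} =
       {PIdl\<^bsub>ring_on (Fpoly n)\<^esub> (z n :: 'k mpol)} \<union>
       {(PIdl\<^bsub>ring_on (Fpoly n)\<^esub> (z n)) <+>\<^bsub>ring_on (Fpoly n)\<^esub>
          (PIdl\<^bsub>ring_on (Fpoly n)\<^esub> (z (n - 1) - Const c :: 'k mpol)) | c. c \<noteq> 0})"
proof (intro conjI impI)
  obtain m where m: "n = Suc m" using assms by (cases n) auto
  have U: "U_L n = (T_L m :: 'k mpol fract set)" using U_L_eq_T_L[of n] m by simp
  show "poisson_simple (L_fbracket n) (T_L n :: 'k mpol fract set)" if "even n"
    using that by (rule poisson_simple_T_L)
  show "is_laurent_ring (T_L n :: 'k mpol fract set) (U_L n) (zf n)"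
    unfolding U unfolding m by (rule is_laurent_ring_T_L)
  show "poisson_subalgebra base_field (L_fbracket n) (T_L n :: 'k mpol fract set) (U_L n)"
    unfolding U poisson_subalgebra_def
    using base_field_T_L
    by (auto simp: m L_fbracket_restrict[of _ m _ "Suc m"] L_fbracket_T_L intro!: subring_ring_onI closed_ring_T_L T_L_mono)
  show "poisson_simple (L_fbracket n) (U_L n :: 'k mpol fract set)" if "odd n"
  proof -
    \<comment> \<open>For odd n the index \<open>m = n - 1\<close> of U is even.\<close>
    have "poisson_simple (L_fbracket m) (T_L m :: 'k mpol fract set)"
      using that m by (intro poisson_simple_T_L) simp
    then show ?thesis
      unfolding U using m
      by (subst poisson_simple_cong[where br' = "L_fbracket m"])
         (auto intro: L_fbracket_restrict closed_ring_T_L)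
  qed
  show "poisson_central (L_fbracket n) (T_L n) (zf n :: 'k mpol fract)" if "odd n"
    using that by (rule poisson_central_zf)
  have PIdl_nz: "{x * a | x. x \<in> Fpoly n} \<noteq> {0}" if "a \<noteq> 0" for a :: "'k mpol"
  proof -
    have "1 * a \<in> {x * a | x. x \<in> Fpoly n}" by blast
    then show ?thesis using that by auto
  qed
  have principal: "is_poisson_prime n {x * (z n - Const c) | x. x \<in> Fpoly n} \<and> {x * (z n - Const c) | x. x \<in> Fpoly n} \<noteq> {0}"
    if "z_admissible n c" for c :: 'k
  proof -
    have "z n - Const c \<noteq> 0" using prime_elem_z_diff_Const[OF that] by auto
    with is_poisson_prime_principal[OF that] PIdl_nz show ?thesis by blast
  qed
  show "{P. poisson_prime_ideal (L_bracket n) (Fpoly n) P \<and> P \<noteq> {0}} =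
       {PIdl\<^bsub>ring_on (Fpoly n)\<^esub> (z n - Const c :: 'k mpol) | c. True}" if "odd n"
    unfolding PIdl_ring_on poisson_prime_ideal_iff
    using is_poisson_prime_odd_cases[OF _ _ that] principal that by (auto simp: z_admissible_def)
  show "{P. poisson_prime_ideal (L_bracket n) (Fpoly n) P \<and> P \<noteq> {0}} =
       {PIdl\<^bsub>ring_on (Fpoly n)\<^esub> (z n :: 'k mpol)} \<union>
       {(PIdl\<^bsub>ring_on (Fpoly n)\<^esub> (z n)) <+>\<^bsub>ring_on (Fpoly n)\<^esub>
          (PIdl\<^bsub>ring_on (Fpoly n)\<^esub> (z (n - 1) - Const c :: 'k mpol)) | c. c \<noteq> 0}" if "even n"
  proof -
    have om: "odd m" using that m by simp
    have 1: "z_pair_ideal m c \<noteq> {0}" for c :: 'k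
      using z_pair_ideal_props(5)[of m c] z_nonzero[of "Suc m"] by (metis singletonD)
    have 2: "is_poisson_prime n {x * (z n :: 'k mpol) | x. x \<in> Fpoly n} \<and>
        {x * (z n :: 'k mpol) | x. x \<in> Fpoly n} \<noteq> {0}"
      using principal[of 0] assms by (simp add: z_admissible_def)
    have "is_poisson_prime n P \<and> P \<noteq> {0} \<longleftrightarrow>
        P = {x * z n | x. x \<in> Fpoly n} \<or> (\<exists>c. c \<noteq> 0 \<and> P = z_pair_ideal m c)" for P :: "'k mpol set"
    proof
      assume "is_poisson_prime n P \<and> P \<noteq> {0}"
      then show "P = {x * z n | x. x \<in> Fpoly n} \<or> (\<exists>c. c \<noteq> 0 \<and> P = z_pair_ideal m c)"
        unfolding m by (intro is_poisson_prime_even_cases[OF _ _ om]) simp_all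
    next
      assume "P = {x * z n | x. x \<in> Fpoly n} \<or> (\<exists>c. c \<noteq> 0 \<and> P = z_pair_ideal m c)"
      then show "is_poisson_prime n P \<and> P \<noteq> {0}"
      proof
        assume "\<exists>c. c \<noteq> 0 \<and> P = z_pair_ideal m c"
        then obtain c where "c \<noteq> 0" "P = z_pair_ideal m c" by blast
        then show ?thesis using is_poisson_prime_z_pair_ideal[OF om] 1 m by simp
      qed (simp only: 2 simp_thms)
    qed
    then have "{P. is_poisson_prime n P \<and> P \<noteq> {0}} =
        {{x * z n | x. x \<in> Fpoly n}} \<union> {z_pair_ideal m c | c :: 'k. c \<noteq> 0}"
      by auto
    then show ?thesis
      unfolding poisson_prime_ideal_iff m diff_Suc_1 z_pair_ideal_eq_sum unfolding PIdl_ring_on .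
  qed
qed

end
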